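(* Let $n\ge 4$, $\mathfrak{g}=sl(n,\mathbb{C})$, and let $C=(\mathrm{End}(\mathfrak{g})\otimes\mathbb{C}[\mathfrak{g}^*])^G$ be the classical family algebra of the adjoint representation, regarded as an algebra over $I(\mathfrak{g})=\mathbb{C}[\mathfrak{g}^*]^G$. Then the following three elements generate $C$ as an $I(\mathfrak{g})$-algebra: $$L = x_\alpha\otimes x^\beta \otimes K^{\alpha\gamma}\,\mathrm{tr}(\pi(x_\beta) \pi(x_\gamma) F),$$ $$R = x_\alpha\otimes x^\beta \otimes K^{\alpha\gamma}\,\mathrm{tr}(\pi(x_\gamma) \pi(x_\beta) F),$$ $$S = x_\alpha\otimes x^\beta \otimes K^{\alpha\gamma}x_\beta x_\gamma .$$
   Context: $\mathfrak{g}=sl(n,\mathbb{C})$, $G$ is the corresponding adjoint Lie group, and $\pi$ is the defining ($n$-dimensional) representation; all traces are taken in $\pi$. $\{x_\alpha\}$ is a basis of $\mathfrak{g}$ and $\{x^\beta\}$ the dual basis of $\mathfrak{g}^*$. Repeated indices are summed. Put $K_{\alpha\beta}=\mathrm{tr}(\pi(x_\alpha)\pi(x_\beta))$, and let $K^{\alpha\beta}$ be the entries of the inverse matrix. $\mathbb{C}[\mathfrak{g}^*]=\mathrm{Sym}(\mathfrak{g})$ is the polynomial ring in the commuting variables $x_\alpha$ (viewed as coordinate functions on $\mathfrak{g}^*$), with the $G$-action induced by the adjoint action, and $I(\mathfrak{g})=\mathbb{C}[\mathfrak{g}^*]^G$. $G$ acts on $\mathrm{End}(\mathfrak{g})$ by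 conjugation by $\mathrm{Ad}(g)$, and $C=(\mathrm{End}(\mathfrak{g})\otimes\mathbb{C}[\mathfrak{g}^*])^G$ consists of the invariants of the resulting action on the tensor product. $I(\mathfrak{g})$ is embedded in $C$ by $P\mapsto \mathrm{Id}_{\mathfrak{g}}\otimes P$. $F=\pi(x_\alpha)\otimes K^{\alpha\beta}x_\beta$ is an $n\times n$ matrix whose entries are degree $1$ polynomials on $\mathfrak{g}^*$; in the traces above, $\pi(x_\beta),\pi(x_\gamma),F$ are regarded as $n\times n$ matrices with entries in $\mathbb{C}[\mathfrak{g}^*]$. Using $\mathrm{End}(\mathfrak{g})\cong\mathfrak{g}\otimes\mathfrak{g}^*$, elements of $\mathrm{End}(\mathfrak{g})\otimes \mathbb{C}[\mathfrak{g}^*]$ are written $x_\alpha\otimes x^\beta\otimes P^\alpha_\beta$ with $P^\alpha_\beta\in\mathbb{C}[\mathfrak{g}^*]$, and multiplication is $(x_\alpha\otimes x^\beta \otimes P_\beta^\alpha)(x_\gamma\otimes x^\delta\otimes Q^\gamma_\delta) = x_\alpha\otimes x^\delta \otimes P_\beta^\alpha Q_\delta^\beta$. *)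

theory Defs
  imports "HOL-Analysis.Analysis" "HOL-Library.Poly_Mapping"
begin

definition mscale :: "complex \<Rightarrow> complex^'n^'n \<Rightarrow> complex^'n^'n" where
  "mscale c A = (\<chi> i j. c * A $ i $ j)"

interpretation mvs: vector_space "mscale :: complex \<Rightarrow> complex^'n^'n \<Rightarrow> complex^'n^'n"
  by unfold_locales (simp_all add: mscale_def vec_eq_iff algebra_simps)

definition sl :: "(complex^'n^'n) set" where
  "sl = {A. trace A = 0}"

definition is_basis :: "('a::finite \<Rightarrow> complex^'n^'n) \<Rightarrow> (complex^'n^'n) set \<Rightarrow> bool" where
  "is_basis x V \<longleftrightarrow> inj x \<and> mvs.independent (range x) \<and> mvs.span (range x) = V"

definition coord :: "('a::finite \<Rightarrow> complex^'n^'n) \<Rightarrow> 'a \<Rightarrow> complex^'n^'n \<Rightarrow> complex" where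
  "coord x \<alpha> A = mvs.representation (range x) A (x \<alpha>)"

definition Ad :: "complex^'n^'n \<Rightarrow> complex^'n^'n \<Rightarrow> complex^'n^'n" where
  "Ad g A = g ** A ** matrix_inv g"

text \<open>The adjoint group is the image of \<open>SL(n)\<close> under \<open>Ad\<close>. Its elements are written as maps
  on all matrices; only their restrictions to \<^const>\<open>sl\<close> are used, and these determine them.\<close>

definition adjoint_group :: "(complex^'n^'n \<Rightarrow> complex^'n^'n) set" where
  "adjoint_group = {Ad g | g. det g = 1}"

text \<open>Columns are images of basis vectors:
  \<open>\<phi> (x \<beta>) = (\<Sum>\<alpha>. basis_matrix x \<phi> $ \<alpha> $ \<beta> \<cdot> x \<alpha>)\<close>.\<close>

definition basis_matrix ::
    "('a::finite \<Rightarrow> complex^'n^'n) \<Rightarrow> (complex^'n^'n \<Rightarrow> complex^'n^'n) \<Rightarrow> complex^'a^'a" where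
  "basis_matrix x \<phi> = (\<chi> \<alpha> \<beta>. coord x \<alpha> (\<phi> (x \<beta>)))"

text \<open>Polynomials over the complex numbers with variables indexed by \<open>'a\<close>. For a basis \<open>x\<close>
  indexed by \<open>'a\<close>, the variable \<open>pvar \<alpha>\<close> is the basis vector \<open>x \<alpha>\<close> as an element of the symmetric
  algebra, that is, as a coordinate function on the dual space.\<close>

type_synonym 'a cpoly = "('a \<Rightarrow>\<^sub>0 nat) \<Rightarrow>\<^sub>0 complex"

definition pconst :: "complex \<Rightarrow> 'a cpoly" where
  "pconst c = Poly_Mapping.single 0 c"

definition pvar :: "'a \<Rightarrow> 'a cpoly" where
  "pvar \<alpha> = Poly_Mapping.single (Poly_Mapping.single \<alpha> 1) 1"

definition psubst :: "('a::finite \<Rightarrow> 'a cpoly) \<Rightarrow> 'a cpoly \<Rightarrow> 'a cpoly" where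
  "psubst f p = (\<Sum>m\<in>Poly_Mapping.keys p.
      pconst (Poly_Mapping.lookup p m) * (\<Prod>\<alpha>\<in>UNIV. f \<alpha> ^ Poly_Mapping.lookup m \<alpha>))"

text \<open>\<^const>\<open>psubst\<close> is the algebra homomorphism with prescribed values on the variables.\<close>

lemma psubst_superset:
  assumes "finite S" "Poly_Mapping.keys p \<subseteq> S"
  shows "psubst f p = (\<Sum>m\<in>S.
      pconst (Poly_Mapping.lookup p m) * (\<Prod>\<alpha>\<in>UNIV. f \<alpha> ^ Poly_Mapping.lookup m \<alpha>))"
  unfolding psubst_def
  by (rule sum.mono_neutral_left) (use assms in \<open>auto simp: pconst_def in_keys_iff\<close>)

lemma psubst_pconst: "psubst f (pconst c) = pconst c"
  by (simp add: psubst_def pconst_def)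

lemma psubst_pvar: "psubst f (pvar \<alpha>) = f \<alpha>"
proof -
  have "(\<Prod>\<beta>\<in>UNIV. f \<beta> ^ Poly_Mapping.lookup (Poly_Mapping.single \<alpha> 1) \<beta>)
      = (\<Prod>\<beta>\<in>UNIV. if \<beta> = \<alpha> then f \<beta> else 1)"
    by (rule prod.cong) (auto simp: lookup_single when_def)
  then show ?thesis by (simp add: psubst_def pvar_def pconst_def)
qed

lemma psubst_add: "psubst f (p + q) = psubst f p + psubst f q"
proof -
  let ?S = "Poly_Mapping.keys p \<union> Poly_Mapping.keys q"
  have "Poly_Mapping.keys (p + q) \<subseteq> ?S" by (rule Poly_Mapping.keys_add)
  then show ?thesis
    by (simp add: psubst_superset[of ?S] lookup_add pconst_def single_add
        sum.distrib algebra_simps)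
qed

lemma psubst_single:
  "psubst f (Poly_Mapping.single m c) =
    pconst c * (\<Prod>\<alpha>\<in>UNIV. f \<alpha> ^ Poly_Mapping.lookup m \<alpha>)"
  by (subst psubst_superset[of "{m}"]) auto

lemma poly_as_sum:
  fixes p :: "'a cpoly"
  shows "p = (\<Sum>m\<in>Poly_Mapping.keys p. Poly_Mapping.single m (Poly_Mapping.lookup p m))"
  by (rule poly_mapping_eqI) (simp add: lookup_sum lookup_single when_def in_keys_iff)

lemma psubst_sum: "psubst f (sum h A) = (\<Sum>i\<in>A. psubst f (h i))"
proof (induction A rule: infinite_finite_induct)
  case (insert i A)
  then show ?case by (simp add: psubst_add)
qed (simp_all add: psubst_def)

lemma psubst_mult: "psubst f (p * q) = psubst f p * psubst f q"
proof -
  have single: "psubst f (Poly_Mapping.single m c * Poly_Mapping.single m' c')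
      = psubst f (Poly_Mapping.single m c) * psubst f (Poly_Mapping.single m' c')" for m m' c c'
  proof -
    have "pconst (c * c') = (pconst c * pconst c' :: 'a cpoly)"
      by (simp add: pconst_def mult_single)
    then show ?thesis
      by (simp add: mult_single psubst_single lookup_add power_add prod.distrib mult_ac)
  qed
  show ?thesis
    by (subst (1 2) poly_as_sum, subst (3) poly_as_sum, subst (5) poly_as_sum)
      (simp only: sum_product psubst_sum single)
qed

text \<open>The action on polynomials extends the given linear map on the variables, so that
  \<open>x \<beta>\<close> is sent to \<open>\<phi> (x \<beta>)\<close>.\<close>

definition poly_act ::
    "('a::finite \<Rightarrow> complex^'n^'n) \<Rightarrow> (complex^'n^'n \<Rightarrow> complex^'n^'n) \<Rightarrow> 'a cpoly \<Rightarrow> 'a cpoly" where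
  "poly_act x \<phi> =
    psubst (\<lambda>\<beta>. \<Sum>\<alpha>\<in>UNIV. pconst (basis_matrix x \<phi> $ \<alpha> $ \<beta>) * pvar \<alpha>)"

definition invariant_polys :: "('a::finite \<Rightarrow> complex^'n^'n) \<Rightarrow> 'a cpoly set" where
  "invariant_polys x = {P. \<forall>\<phi>\<in>adjoint_group. poly_act x \<phi> P = P}"

text \<open>The element \<open>x\<^sub>\<alpha> \<otimes> x\<^sup>\<beta> \<otimes> P\<^sup>\<alpha>\<^sub>\<beta>\<close> of \<open>End(g) \<otimes> \<complex>[g\<^sup>*]\<close> is represented by the matrix with entry
  \<open>P\<^sup>\<alpha>\<^sub>\<beta>\<close> in row \<open>\<alpha>\<close> and column \<open>\<beta>\<close>. The product is then the matrix product \<open>**\<close>, and \<open>Id \<otimes> P\<close>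
  is \<open>mat P\<close>.\<close>

definition end_act ::
    "('a::finite \<Rightarrow> complex^'n^'n) \<Rightarrow> (complex^'n^'n \<Rightarrow> complex^'n^'n)
      \<Rightarrow> 'a cpoly^'a^'a \<Rightarrow> 'a cpoly^'a^'a" where
  "end_act x \<phi> T =
    map_matrix pconst (basis_matrix x \<phi>) ** map_matrix (poly_act x \<phi>) T
      ** map_matrix pconst (matrix_inv (basis_matrix x \<phi>))"

definition family_algebra :: "('a::finite \<Rightarrow> complex^'n^'n) \<Rightarrow> ('a cpoly^'a^'a) set" where
  "family_algebra x = {T. \<forall>\<phi>\<in>adjoint_group. end_act x \<phi> T = T}"

text \<open>The unital subalgebra generated by \<open>X\<close> over a coefficient ring \<open>I\<close> of scalar matrices;
  it contains \<open>mat P\<close> for every \<open>P \<in> I\<close>.\<close>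

inductive_set generated_algebra :: "'p::comm_ring_1 set \<Rightarrow> ('p^'a^'a::finite) set \<Rightarrow> ('p^'a^'a) set"
  for I :: "'p set" and X :: "('p^'a^'a) set" where
  coeff: "P \<in> I \<Longrightarrow> mat P \<in> generated_algebra I X"
| gener: "T \<in> X \<Longrightarrow> T \<in> generated_algebra I X"
| add: "T \<in> generated_algebra I X \<Longrightarrow> U \<in> generated_algebra I X \<Longrightarrow> T + U \<in> generated_algebra I X"
| mult: "T \<in> generated_algebra I X \<Longrightarrow> U \<in> generated_algebra I X \<Longrightarrow> T ** U \<in> generated_algebra I X"

definition trace_form :: "('a::finite \<Rightarrow> complex^'n^'n) \<Rightarrow> complex^'a^'a" where
  "trace_form x = (\<chi> \<alpha> \<beta>. trace (x \<alpha> ** x \<beta>))"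

definition inv_trace_form :: "('a::finite \<Rightarrow> complex^'n^'n) \<Rightarrow> complex^'a^'a" where
  "inv_trace_form x = matrix_inv (trace_form x)"

definition F_mat :: "('a::finite \<Rightarrow> complex^'n^'n) \<Rightarrow> 'a cpoly^'n^'n" where
  "F_mat x = (\<chi> i j. \<Sum>\<alpha>\<in>UNIV. \<Sum>\<beta>\<in>UNIV.
      pconst (x \<alpha> $ i $ j) * (pconst (inv_trace_form x $ \<alpha> $ \<beta>) * pvar \<beta>))"

definition L_elt :: "('a::finite \<Rightarrow> complex^'n^'n) \<Rightarrow> 'a cpoly^'a^'a" where
  "L_elt x = (\<chi> \<alpha> \<beta>. \<Sum>\<gamma>\<in>UNIV. pconst (inv_trace_form x $ \<alpha> $ \<gamma>) *
      trace (map_matrix pconst (x \<beta>) ** map_matrix pconst (x \<gamma>) ** F_mat x))"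

definition R_elt :: "('a::finite \<Rightarrow> complex^'n^'n) \<Rightarrow> 'a cpoly^'a^'a" where
  "R_elt x = (\<chi> \<alpha> \<beta>. \<Sum>\<gamma>\<in>UNIV. pconst (inv_trace_form x $ \<alpha> $ \<gamma>) *
      trace (map_matrix pconst (x \<gamma>) ** map_matrix pconst (x \<beta>) ** F_mat x))"

definition S_elt :: "('a::finite \<Rightarrow> complex^'n^'n) \<Rightarrow> 'a cpoly^'a^'a" where
  "S_elt x = (\<chi> \<alpha> \<beta>. \<Sum>\<gamma>\<in>UNIV. pconst (inv_trace_form x $ \<alpha> $ \<gamma>) * (pvar \<beta> * pvar \<gamma>))"

end

theory Submission
  imports Defs "HOL-Computational_Algebra.Fundamental_Theorem_Algebra"
begin

text \<open>
  The trace form identifies \<open>g = sl(n)\<close> with its dual. An element of \<open>End(g) \<otimes> \<complex>[g\<^sup>*]\<close> then becomes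
  a family of operators \<open>T\<^sub>A\<close> on \<open>g\<close> that depends polynomially on \<open>A \<in> g\<close>, and it lies in the family
  algebra exactly if \<open>T\<close> is equivariant under simultaneous conjugation (\<open>family_algebra_iff\<close>). Let
  \<open>pr\<close> be the projection onto traceless matrices. The three generators are the families
  \<open>Y \<mapsto> pr(A Y)\<close>, \<open>Y \<mapsto> pr(Y A)\<close> and \<open>Y \<mapsto> tr(A Y) A\<close>, so they are equivariant. The converse
  rests on two facts.

  First, every equivariant polynomial family is a combination of the words \<open>Y \<mapsto> A\<^sup>k Y A\<^sup>l\<close> and
  \<open>Y \<mapsto> tr(A\<^sup>l Y) A\<^sup>k\<close> with invariant polynomials as coefficients (\<open>covariant_decomposition\<close>). This is
  a case of the first fundamental theorem for invariants of matrices, proved here directly. It is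
  enough to treat \<open>A = diag(\<mu>\<^sub>1, \<dots>, \<mu>\<^sub>n)\<close> with distinct \<open>\<mu>\<^sub>i\<close>, because the
  conjugates of these matrices are dense (\<open>matpoly_zero_density\<close>). Equivariance under the diagonal
  torus gives \<open>T(E\<^sub>i\<^sub>j) = p\<^sub>i\<^sub>j E\<^sub>i\<^sub>j\<close> for \<open>i \<noteq> j\<close> and \<open>T(E\<^sub>j\<^sub>j) = \<Sum>\<^sub>i m\<^sub>i\<^sub>j E\<^sub>i\<^sub>i\<close>. What has to be found are
  two polynomials in two variables, with coefficients that are polynomials in the coefficients of the
  characteristic polynomial, whose values at \<open>(\<mu>\<^sub>i, \<mu>\<^sub>j)\<close> are \<open>p\<^sub>i\<^sub>j\<close> and \<open>m\<^sub>i\<^sub>j\<close>. Lagrange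
  interpolation would bring in denominators. The companion matrix \<open>C\<close> of the characteristic
  polynomial avoids them: \<open>C\<close> is conjugate to \<open>A\<close>, its entries are polynomials in these coefficients,
  and it has eigenvectors that are polynomial in the eigenvalue and the coefficients, with some entry
  equal to \<open>1\<close>. Hence \<open>p\<^sub>i\<^sub>j\<close> is an entry
  of the value of \<open>T\<^sub>C\<close> at a product of eigenvectors (\<open>offdiag_coeff_eigenvalue\<close>). After this part
  of \<open>T\<close> has been subtracted, certain entries of \<open>T\<^sub>C\<close> are weighted moments of the remaining \<open>m\<^sub>i\<^sub>j\<close>,
  from which the Bezoutian of the characteristic polynomial recovers \<open>m\<^sub>i\<^sub>j\<close> (\<open>diag_coeff_eigenvalue\<close>).

  Second, the traceless parts of all words are generated by the three elements
  (\<open>generated_family_dyad\<close> and \<open>generated_family_sandwich\<close>): composition with the first two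
  generators raises the exponents, up to terms that come from lower words.
\<close>

section \<open>Evaluating polynomials\<close>

definition peval :: "'a::finite cpoly \<Rightarrow> ('a \<Rightarrow> complex) \<Rightarrow> complex" where
  "peval P \<xi> = (\<Sum>m\<in>Poly_Mapping.keys P.
      Poly_Mapping.lookup P m * (\<Prod>\<alpha>\<in>UNIV. \<xi> \<alpha> ^ Poly_Mapping.lookup m \<alpha>))"

lemma pconst_0 [simp]: "pconst 0 = 0" and pconst_1: "pconst 1 = 1"
  by (simp_all add: pconst_def)

lemma pconst_add: "pconst (c + d) = pconst c + pconst d"
  by (simp add: pconst_def single_add)

lemma pconst_mult: "pconst (c * d) = pconst c * pconst d"
  by (simp add: pconst_def mult_single)

lemma pconst_sum: "pconst (sum f A) = (\<Sum>i\<in>A. pconst (f i))"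
  by (induction A rule: infinite_finite_induct) (simp_all add: pconst_add)

lemma pconst_prod: "pconst (prod f A) = (\<Prod>i\<in>A. pconst (f i))"
  by (induction A rule: infinite_finite_induct) (simp_all add: pconst_mult pconst_1)

lemma pconst_power: "pconst (c ^ k) = pconst c ^ k"
  by (induction k) (simp_all add: pconst_mult pconst_1)

lemma pconst_eq_iff [simp]: "pconst c = pconst d \<longleftrightarrow> c = d"
  unfolding pconst_def by (metis lookup_single_eq)

lemma psubst_pconst_eq_peval: "psubst (\<lambda>\<alpha>. pconst (\<xi> \<alpha>)) P = pconst (peval P \<xi>)"
  by (simp add: psubst_def peval_def pconst_sum pconst_mult pconst_prod pconst_power)

lemma peval_add [simp]: "peval (P + Q) \<xi> = peval P \<xi> + peval Q \<xi>"
  using psubst_add[of "\<lambda>\<alpha>. pconst (\<xi> \<alpha>)" P Q]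
  by (simp add: psubst_pconst_eq_peval flip: pconst_add)

lemma peval_mult [simp]: "peval (P * Q) \<xi> = peval P \<xi> * peval Q \<xi>"
  using psubst_mult[of "\<lambda>\<alpha>. pconst (\<xi> \<alpha>)" P Q]
  by (simp add: psubst_pconst_eq_peval flip: pconst_mult)

lemma peval_pconst [simp]: "peval (pconst c) \<xi> = c"
  using psubst_pconst[of "\<lambda>\<alpha>. pconst (\<xi> \<alpha>)" c] by (simp add: psubst_pconst_eq_peval)

lemma peval_pvar [simp]: "peval (pvar \<alpha>) \<xi> = \<xi> \<alpha>"
  using psubst_pvar[of "\<lambda>\<alpha>. pconst (\<xi> \<alpha>)" \<alpha>] by (simp add: psubst_pconst_eq_peval)

lemma peval_0 [simp]: "peval 0 \<xi> = 0"
  by (simp add: peval_def)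

lemma peval_1 [simp]: "peval 1 \<xi> = 1"
  using peval_pconst[of 1] by (simp add: pconst_1)

lemma peval_minus [simp]: "peval (- P) \<xi> = - peval P \<xi>"
  using peval_add[of P "- P" \<xi>] by (simp add: eq_neg_iff_add_eq_0 add.commute)

lemma peval_diff [simp]: "peval (P - Q) \<xi> = peval P \<xi> - peval Q \<xi>"
  using peval_add[of P "- Q" \<xi>] by simp

lemma peval_sum: "peval (sum f A) \<xi> = (\<Sum>i\<in>A. peval (f i) \<xi>)"
  by (induction A rule: infinite_finite_induct) simp_all

lemma peval_prod: "peval (prod f A) \<xi> = (\<Prod>i\<in>A. peval (f i) \<xi>)"
  by (induction A rule: infinite_finite_induct) simp_all

lemma peval_power: "peval (P ^ k) \<xi> = peval P \<xi> ^ k"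
  by (induction k) simp_all

lemma peval_psubst: "peval (psubst f P) \<xi> = peval P (\<lambda>\<alpha>. peval (f \<alpha>) \<xi>)"
  by (simp add: psubst_def peval_sum peval_prod peval_power)
    (simp add: peval_def)

text \<open>The variables are eliminated one at a time: grouping the monomials by the exponent of one
  variable gives a one-variable polynomial with infinitely many roots.\<close>

lemma monomials_linearly_independent:
  fixes c :: "('a \<Rightarrow> nat) \<Rightarrow> complex"
  assumes "finite S" "finite M"
    and "\<And>m m'. m \<in> M \<Longrightarrow> m' \<in> M \<Longrightarrow> (\<And>\<alpha>. \<alpha> \<in> S \<Longrightarrow> m \<alpha> = m' \<alpha>) \<Longrightarrow> m = m'"
    and "\<And>\<xi>. (\<Sum>m\<in>M. c m * (\<Prod>\<alpha>\<in>S. \<xi> \<alpha> ^ m \<alpha>)) = 0"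
    and "m \<in> M"
  shows "c m = 0"
  using assms
proof (induction S arbitrary: M m rule: finite_induct)
  case empty
  have "M = {m}" using empty.prems(2,4) by auto
  then show ?case using empty.prems(3) by simp
next
  case (insert \<beta> S)
  let ?d = "m \<beta>" and ?N = "Max ((\<lambda>m. m \<beta>) ` M)"
  define g where "g \<xi> k = (\<Sum>m\<in>{m\<in>M. m \<beta> = k}. c m * (\<Prod>\<alpha>\<in>S. \<xi> \<alpha> ^ m \<alpha>))" for \<xi> k
  have le: "m' \<beta> \<le> ?N" if "m' \<in> M" for m'
    using insert.prems(1) that by simp
  have "g \<xi> k = 0" if "k \<le> ?N" for \<xi> :: "'a \<Rightarrow> complex" and k
  proof -
    have "(\<Sum>k\<le>?N. g \<xi> k * t ^ k) = 0" for t
    proof -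
      let ?\<xi> = "\<xi>(\<beta> := t)"
      have "(\<Sum>k\<le>?N. g \<xi> k * t ^ k)
          = (\<Sum>k\<le>?N. \<Sum>m\<in>{m\<in>M. m \<beta> = k}. c m * (\<Prod>\<alpha>\<in>insert \<beta> S. ?\<xi> \<alpha> ^ m \<alpha>))"
      proof (rule sum.cong, simp)
        fix k
        have "(\<Prod>\<alpha>\<in>insert \<beta> S. ?\<xi> \<alpha> ^ m \<alpha>) = t ^ m \<beta> * (\<Prod>\<alpha>\<in>S. \<xi> \<alpha> ^ m \<alpha>)" for m
        proof -
          have "(\<Prod>\<alpha>\<in>S. ?\<xi> \<alpha> ^ m \<alpha>) = (\<Prod>\<alpha>\<in>S. \<xi> \<alpha> ^ m \<alpha>)"
            using insert.hyps by (intro prod.cong) auto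
          then show ?thesis using insert.hyps by simp
        qed
        then show "g \<xi> k * t ^ k
            = (\<Sum>m\<in>{m\<in>M. m \<beta> = k}. c m * (\<Prod>\<alpha>\<in>insert \<beta> S. ?\<xi> \<alpha> ^ m \<alpha>))"
          by (auto simp: g_def sum_distrib_right intro!: sum.cong)
      qed
      also have "\<dots> = (\<Sum>m\<in>M. c m * (\<Prod>\<alpha>\<in>insert \<beta> S. ?\<xi> \<alpha> ^ m \<alpha>))"
        using insert.prems(1) le by (intro sum.group) auto
      finally show ?thesis using insert.prems(3) by simp
    qed
    then show ?thesis
      using polyfun_eq_0[of "g \<xi>" ?N] that by simp
  qed
  then have 0: "g \<xi> ?d = 0" for \<xi>
    using le[OF insert.prems(4)] by simp
  show ?case
  proof (rule insert.IH[of "{m'\<in>M. m' \<beta> = ?d}"])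
    show "m' = m''" if "m' \<in> {m'\<in>M. m' \<beta> = ?d}" "m'' \<in> {m'\<in>M. m' \<beta> = ?d}"
      "\<And>\<alpha>. \<alpha> \<in> S \<Longrightarrow> m' \<alpha> = m'' \<alpha>" for m' m''
      using that by (intro insert.prems(2)) auto
  qed (use insert.prems 0 in \<open>auto simp: g_def\<close>)
qed

lemma peval_eq_0_imp_eq_0:
  assumes "\<And>\<xi>. peval P \<xi> = 0"
  shows "P = 0"
proof (rule poly_mapping_eqI)
  fix m
  let ?M = "Poly_Mapping.lookup ` Poly_Mapping.keys P"
  define c where "c f = Poly_Mapping.lookup P (Abs_poly_mapping f)" for f
  have sums: "(\<Sum>f\<in>?M. c f * (\<Prod>\<alpha>\<in>UNIV. \<xi> \<alpha> ^ f \<alpha>)) = peval P \<xi>" for \<xi>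
    unfolding peval_def c_def
    by (subst sum.reindex) (auto simp: inj_on_def lookup_inverse poly_mapping.lookup_inject)
  have "Poly_Mapping.lookup P m = 0" if "m \<in> Poly_Mapping.keys P"
  proof -
    have "c (Poly_Mapping.lookup m) = 0"
      by (rule monomials_linearly_independent[of UNIV ?M]) (use sums assms that in auto)
    then show ?thesis by (simp add: c_def lookup_inverse)
  qed
  then show "Poly_Mapping.lookup P m = Poly_Mapping.lookup 0 m"
    by (cases "m \<in> Poly_Mapping.keys P") (auto simp: in_keys_iff)
qed

lemma peval_eq_imp_eq:
  assumes "\<And>\<xi>. peval P \<xi> = peval Q \<xi>"
  shows "P = Q"
  using peval_eq_0_imp_eq_0[of "P - Q"] assms by simp

section \<open>Polynomial functions of a matrix\<close>

text \<open>The domain consists of all matrices, not of the traceless ones, because these functions are to be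
  composed with the companion matrix.\<close>

inductive matpoly :: "(complex^'n^'n \<Rightarrow> complex) \<Rightarrow> bool" where
  const: "matpoly (\<lambda>A. c)"
| entry: "matpoly (\<lambda>A. A $ i $ j)"
| add: "matpoly f \<Longrightarrow> matpoly g \<Longrightarrow> matpoly (\<lambda>A. f A + g A)"
| mult: "matpoly f \<Longrightarrow> matpoly g \<Longrightarrow> matpoly (\<lambda>A. f A * g A)"

lemma matpoly_sum: "(\<And>i. i \<in> I \<Longrightarrow> matpoly (f i)) \<Longrightarrow> matpoly (\<lambda>A. \<Sum>i\<in>I. f i A)"
  by (induction I rule: infinite_finite_induct) (simp_all add: matpoly.const matpoly.add)

lemma matpoly_prod: "(\<And>i. i \<in> I \<Longrightarrow> matpoly (f i)) \<Longrightarrow> matpoly (\<lambda>A. \<Prod>i\<in>I. f i A)"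
  by (induction I rule: infinite_finite_induct) (simp_all add: matpoly.const matpoly.mult)

lemma matpoly_power: "matpoly f \<Longrightarrow> matpoly (\<lambda>A. f A ^ k)"
  by (induction k) (simp_all add: matpoly.const matpoly.mult)

lemma matpoly_diff: "matpoly f \<Longrightarrow> matpoly g \<Longrightarrow> matpoly (\<lambda>A. f A - g A)"
  using matpoly.add[of f, OF _ matpoly.mult[OF matpoly.const[of "-1"], of g]] by simp

lemma matpoly_compose:
  assumes "matpoly f" and "\<And>i j. matpoly (\<lambda>A. c A $ i $ j)"
  shows "matpoly (\<lambda>A. f (c A))"
  using assms by (induction rule: matpoly.induct) (auto intro: matpoly.intros)

lemma matpoly_mat_mult:
  assumes "\<And>i j. matpoly (\<lambda>A. c A $ i $ j)" and "\<And>i j. matpoly (\<lambda>A. d A $ i $ j)"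
  shows "matpoly (\<lambda>A. (c A ** d A) $ i $ j)"
  unfolding matrix_matrix_mult_def using assms
  by (auto intro!: matpoly_sum matpoly.mult)

lemma matpoly_trace:
  assumes "\<And>i j. matpoly (\<lambda>A. c A $ i $ j)"
  shows "matpoly (\<lambda>A. trace (c A))"
  unfolding trace_def using assms by (auto intro!: matpoly_sum)

lemma matpoly_peval:
  assumes "\<And>\<alpha>. matpoly (\<lambda>A. \<xi> A \<alpha>)"
  shows "matpoly (\<lambda>A. peval P (\<xi> A))"
  unfolding peval_def
  by (intro matpoly_sum matpoly.mult matpoly.const matpoly_prod matpoly_power assms)

lemma matpoly_on_line:
  assumes "matpoly f"
  shows "\<exists>q. \<forall>s. f (\<chi> i j. B $ i $ j + s * D $ i $ j) = poly q s"
  using assms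
proof (induction rule: matpoly.induct)
  case (const c)
  show ?case by (rule exI[of _ "[:c:]"]) simp
next
  case (entry i j)
  show ?case by (rule exI[of _ "[:B $ i $ j, D $ i $ j:]"]) simp
next
  case (add f g)
  then obtain p q where "\<forall>s. f (\<chi> i j. B $ i $ j + s * D $ i $ j) = poly p s"
    "\<forall>s. g (\<chi> i j. B $ i $ j + s * D $ i $ j) = poly q s" by blast
  then show ?case by (intro exI[of _ "p + q"]) simp
next
  case (mult f g)
  then obtain p q where "\<forall>s. f (\<chi> i j. B $ i $ j + s * D $ i $ j) = poly p s"
    "\<forall>s. g (\<chi> i j. B $ i $ j + s * D $ i $ j) = poly q s" by blast
  then show ?case by (intro exI[of _ "p * q"]) simp
qed

section \<open>Powers and diagonal matrices\<close>

lemma matrix_diff_right_distrib: "A ** (B - C) = A ** B - A ** C"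
  for A :: "'r::ring_1^'n^'m"
  by (simp add: vec_eq_iff matrix_matrix_mult_def sum_subtractf algebra_simps)

lemma matrix_diff_left_distrib: "(A - B) ** C = A ** C - B ** C"
  for A :: "'r::ring_1^'n^'m"
  by (simp add: vec_eq_iff matrix_matrix_mult_def sum_subtractf algebra_simps)

primrec mpow :: "complex^'n^'n \<Rightarrow> nat \<Rightarrow> complex^'n^'n" where
  "mpow A 0 = mat 1"
| "mpow A (Suc k) = A ** mpow A k"

lemma mpow_1: "mpow A (Suc 0) = A"
  by simp

lemma mpow_Suc_right: "mpow A (Suc k) = mpow A k ** A"
proof (induction k)
  case (Suc k)
  then show ?case by (metis matrix_mul_assoc mpow.simps(2))
qed simp

lemma mpow_add: "mpow A (k + l) = mpow A k ** mpow A l"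
  by (induction k) (simp_all add: matrix_mul_assoc)

lemma mpow_intertwine:
  assumes "A' ** g = g ** A"
  shows "mpow A' k ** g = g ** mpow A k"
proof (induction k)
  case (Suc k)
  have "mpow A' (Suc k) ** g = A' ** g ** mpow A k"
    using Suc by (simp flip: matrix_mul_assoc)
  then show ?case using assms by (simp add: matrix_mul_assoc)
qed simp

lemma matpoly_mpow: "matpoly (\<lambda>A. mpow A k $ i $ j)"
proof (induction k arbitrary: i j)
  case 0
  then show ?case by (simp add: mat_def matpoly.const)
next
  case (Suc k)
  then show ?case by (simp add: matpoly_mat_mult matpoly.entry)
qed

definition diagmat :: "('n \<Rightarrow> complex) \<Rightarrow> complex^'n^'n" where
  "diagmat \<mu> = (\<chi> i j. if i = j then \<mu> i else 0)"

lemma diagmat_nth [simp]: "diagmat \<mu> $ i $ j = (if i = j then \<mu> i else 0)"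
  by (simp add: diagmat_def)

lemma diagmat_mult_nth [simp]: "(diagmat \<mu> ** A) $ i $ j = \<mu> i * A $ i $ j"
  unfolding matrix_matrix_mult_def diagmat_def
  by (simp add: if_distrib if_distribR cong: if_cong)

lemma mult_diagmat_nth [simp]: "(A ** diagmat \<mu>) $ i $ j = A $ i $ j * \<mu> j"
  unfolding matrix_matrix_mult_def diagmat_def
  by (simp add: if_distrib if_distribR cong: if_cong)

lemma mpow_diagmat: "mpow (diagmat \<mu>) k = diagmat (\<lambda>i. \<mu> i ^ k)"
proof (induction k)
  case 0
  show ?case by (simp add: vec_eq_iff mat_def)
next
  case (Suc k)
  then show ?case by (simp add: vec_eq_iff)
qed

lemma trace_diagmat_mult: "trace (diagmat \<mu> ** A) = (\<Sum>i\<in>UNIV. \<mu> i * A $ i $ i)"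
  by (simp add: trace_def)

lemma trace_intertwine:
  fixes g A A' :: "complex^'n^'n"
  assumes "invertible g" "A' ** g = g ** A"
  shows "trace A' = trace A"
proof -
  obtain h where h: "g ** h = mat 1" "h ** g = mat 1"
    using assms(1) unfolding invertible_def by blast
  have "A' = A' ** g ** h"
    using h(1) by (simp flip: matrix_mul_assoc)
  then have "trace A' = trace (g ** A ** h)"
    using assms(2) by simp
  also have "\<dots> = trace (h ** (g ** A))"
    by (rule trace_mul_sym)
  finally show ?thesis using h(2) by (simp add: matrix_mul_assoc)
qed

section \<open>The characteristic polynomial\<close>

definition charpoly :: "complex^'n^'n \<Rightarrow> complex poly" where
  "charpoly A = det (\<chi> i j. (if i = j then [:0, 1:] else 0) - [:A $ i $ j:])"

lemma poly_sign: "poly (of_int k) t = of_int k"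
  by (metis of_int_poly poly_const_conv)

lemma poly_charpoly: "poly (charpoly A) t = det (\<chi> i j. (if i = j then t else 0) - A $ i $ j)"
  unfolding charpoly_def det_def
  by (simp add: poly_sum poly_prod poly_sign if_distrib[of "\<lambda>p. poly p t"] cong: if_cong)

lemma charpoly_diagmat: "charpoly (diagmat \<mu>) = (\<Prod>i\<in>UNIV. [:- \<mu> i, 1:])"
  unfolding charpoly_def by (subst det_diagonal) simp_all

lemma matpoly_coeff_charpoly: "matpoly (\<lambda>A. coeff (charpoly A) k)"
proof -
  have mult: "\<forall>k. matpoly (\<lambda>A. coeff (p A * q A) k)"
    if "\<forall>k. matpoly (\<lambda>A. coeff (p A) k)" "\<forall>k. matpoly (\<lambda>A. coeff (q A) k)"
    for p q :: "complex^'n^'n \<Rightarrow> complex poly"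
    using that by (auto simp: coeff_mult intro!: matpoly_sum matpoly.mult)
  have prod: "\<forall>k. matpoly (\<lambda>A. coeff (\<Prod>i\<in>I. p i A) k)"
    if "\<And>i k. i \<in> I \<Longrightarrow> matpoly (\<lambda>A. coeff (p i A) k)"
    for p :: "'n \<Rightarrow> complex^'n^'n \<Rightarrow> complex poly" and I
    using that
  proof (induction I rule: infinite_finite_induct)
    case (insert i I)
    then show ?case using mult[of "p i" "\<lambda>A. \<Prod>i\<in>I. p i A"] by simp
  qed (auto simp: matpoly.const)
  have "matpoly (\<lambda>A. coeff (((if i = j then [:0, 1:] else 0) - [:A $ i $ j:])) k)" for i j k
  proof -
    have "matpoly (\<lambda>A. coeff [:A $ i $ j:] k)"
      by (cases k) (auto simp: coeff_pCons matpoly.const matpoly.entry)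
    then show ?thesis
      unfolding coeff_diff by (intro matpoly_diff matpoly.const)
  qed
  then show ?thesis
    unfolding charpoly_def det_def coeff_sum
    by (intro matpoly_sum mult[rule_format] prod[rule_format])
      (simp_all only: vec_lambda_beta matpoly.const)
qed

text \<open>Only the identity permutation contributes to the degree of the determinant.\<close>

lemma charpoly_monic:
  fixes A :: "complex^'n^'n"
  shows "degree (charpoly A) = CARD('n)" and "lead_coeff (charpoly A) = 1"
proof -
  let ?M = "\<lambda>i j. (if i = j then [:0, 1:] else 0) - [:A $ i $ j:]"
  let ?D = "\<Prod>i\<in>UNIV. ?M i i"
  have D_eq: "?D = (\<Prod>i\<in>UNIV. [:- A $ i $ i, 1:])" by simp
  have deg: "degree ?D = CARD('n)"
    unfolding D_eq by (subst degree_prod_eq_sum_degree) simp_all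
  have lead: "lead_coeff ?D = 1"
    unfolding D_eq lead_coeff_prod by simp
  let ?R = "\<Sum>p\<in>{p. p permutes UNIV} - {id}. of_int (sign p) * (\<Prod>i\<in>UNIV. ?M i (p i))"
  have split: "charpoly A = ?D + ?R"
    unfolding charpoly_def det_def
    by (subst sum.remove[of _ id]) (simp_all add: permutes_id finite_permutations sign_id)
  have "degree (of_int (sign p) * (\<Prod>i\<in>UNIV. ?M i (p i))) < CARD('n)"
    if "p \<in> {p. p permutes UNIV} - {id}" for p :: "'n \<Rightarrow> 'n"
  proof -
    from that obtain i0 where i0: "p i0 \<noteq> i0" by fastforce
    have "degree (of_int (sign p) * (\<Prod>i\<in>UNIV. ?M i (p i)))
        \<le> degree (\<Prod>i\<in>UNIV. ?M i (p i))"
      by (cases p rule: sign_cases) auto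
    also have "\<dots> \<le> (\<Sum>i\<in>UNIV. degree (?M i (p i)))"
      by (rule degree_prod_sum_le[unfolded o_def]) simp
    also have "\<dots> \<le> (\<Sum>i\<in>UNIV. if i = i0 then 0 else 1)"
      using i0 by (intro sum_mono) auto
    also have "\<dots> = CARD('n) - 1"
      by (simp add: sum.If_cases Compl_eq_Diff_UNIV card_Diff_singleton)
    finally show ?thesis using zero_less_card_finite[where 'a='n] by linarith
  qed
  then have R: "degree ?R < CARD('n)"
    by (intro degree_sum_less) auto
  show "degree (charpoly A) = CARD('n)"
    unfolding split using R deg by (simp add: degree_add_eq_left)
  then show "lead_coeff (charpoly A) = 1"
    using R deg lead unfolding split by (simp add: coeff_eq_0)
qed

lemma charpoly_intertwine:
  fixes g A A' :: "complex^'n^'n"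
  assumes "invertible g" "A' ** g = g ** A"
  shows "charpoly A' = charpoly A"
proof -
  have "poly (charpoly A') t = poly (charpoly A) t" for t
  proof -
    let ?M = "\<lambda>A. (\<chi> i j. (if i = j then t else 0) - A $ i $ j) :: complex^'n^'n"
    have eq: "?M A = mat t - A" for A :: "complex^'n^'n"
      by (simp add: vec_eq_iff mat_def)
    have "mat t = (diagmat (\<lambda>i. t) :: complex^'n^'n)"
      by (simp add: vec_eq_iff mat_def)
    moreover have "diagmat (\<lambda>i. t) ** g = g ** diagmat (\<lambda>i. t)"
      by (simp add: vec_eq_iff)
    ultimately have "mat t ** g = g ** mat t" by simp
    then have "?M A' ** g = g ** ?M A"
      unfolding eq matrix_diff_left_distrib matrix_diff_right_distrib using assms(2) by simp
    then have "det (?M A' ** g) = det (g ** ?M A)"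
      by (rule arg_cong)
    then have "det (?M A') * det g = det g * det (?M A)"
      unfolding det_mul .
    then show ?thesis
      using assms(1) by (simp add: poly_charpoly invertible_det_nz)
  qed
  then show ?thesis by (simp add: fun_eq_iff flip: poly_eq_poly_eq_iff)
qed

section \<open>Density of matrices with distinct eigenvalues\<close>

lemma invertible_iff_ker:
  "invertible A \<longleftrightarrow> (\<forall>u. A *v u = 0 \<longrightarrow> u = 0)" for A :: "'r::field^'n^'n"
  by (simp add: invertible_left_inverse matrix_left_invertible_ker)

lemma diagmat_vec_nth [simp]: "(diagmat \<mu> *v c) $ i = \<mu> i * c $ i"
  by (simp add: matrix_vector_mult_def if_distrib if_distribR cong: if_cong)

text \<open>If \<open>c\<close> is in the kernel of \<open>g\<close>, so is \<open>(\<Lambda> - \<mu>\<^sub>j) c\<close>; applying this for all \<open>j \<noteq> i\<close> isolates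
  the coordinate \<open>c\<^sub>i\<close>.\<close>

lemma distinct_eigenvectors_invertible:
  fixes X g :: "complex^'n^'n"
  assumes X: "X ** g = g ** diagmat \<mu>" and "inj \<mu>" and nz: "\<And>i. column i g \<noteq> 0"
  shows "invertible g"
  unfolding invertible_iff_ker
proof (intro allI impI)
  fix c :: "complex^'n"
  assume c: "g *v c = 0"
  have step: "g *v (\<chi> k. (\<mu> k - t) * d $ k) = 0" if "g *v d = 0" for d t
  proof -
    have "diagmat \<mu> *v d = (\<chi> k. \<mu> k * d $ k)"
      by (simp add: vec_eq_iff)
    then have "g *v (\<chi> k. \<mu> k * d $ k) = X *v (g *v d)"
      using X by (metis matrix_vector_mul_assoc)
    also have "\<dots> = 0" using that by simp
    finally have "g *v (\<chi> k. \<mu> k * d $ k) = 0" .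
    then show ?thesis
      using that by (simp add: vec_eq_iff matrix_vector_mult_def algebra_simps sum_subtractf
          flip: sum_distrib_left)
  qed
  have ker: "g *v (\<chi> k. (\<Prod>j\<in>J. \<mu> k - \<mu> j) * c $ k) = 0" if "finite J" for J
    using that
  proof (induction J rule: finite_induct)
    case empty
    then show ?case using c by simp
  next
    case (insert j J)
    then show ?case using step[of "\<chi> k. (\<Prod>j\<in>J. \<mu> k - \<mu> j) * c $ k" "\<mu> j"]
      by (simp add: mult.assoc)
  qed
  show "c = 0"
    unfolding vec_eq_iff
  proof
    fix i
    let ?p = "\<Prod>j\<in>UNIV - {i}. \<mu> i - \<mu> j"
    have "(\<Prod>j\<in>UNIV - {i}. \<mu> k - \<mu> j) * c $ k = (if k = i then ?p * c $ i else 0)" for k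
    proof (cases "k = i")
      case False
      then have "(\<Prod>j\<in>UNIV - {i}. \<mu> k - \<mu> j) = 0"
        by (intro prod_zero) auto
      then show ?thesis using False by simp
    qed simp
    then have "g *v (\<chi> k. if k = i then ?p * c $ i else 0) = 0"
      using ker[of "UNIV - {i}"] by simp
    then have *: "\<forall>r. (\<Sum>k\<in>UNIV. g $ r $ k * (if k = i then ?p * c $ i else 0)) = 0"
      by (simp add: vec_eq_iff matrix_vector_mult_def)
    have "g $ r $ i * (?p * c $ i) = 0" for r
      using spec[OF *, of r]
      by (simp only: if_distrib mult_zero_right sum.delta finite UNIV_I if_True)
    moreover obtain r where "g $ r $ i \<noteq> 0"
      using nz[of i] by (auto simp: column_def vec_eq_iff)
    moreover have "?p \<noteq> 0"
      using \<open>inj \<mu>\<close> by (auto simp: inj_def)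
    ultimately have "c $ i = 0" by (metis mult_eq_0_iff)
    then show "c $ i = 0 $ i" by simp
  qed
qed

lemma diagonalize_distinct_eigenvalues:
  fixes X :: "complex^'n^'n" and \<mu> :: "'n \<Rightarrow> complex"
  assumes "inj \<mu>" and root: "\<And>i. poly (charpoly X) (\<mu> i) = 0"
  shows "\<exists>g :: complex^'n^'n. invertible g \<and> X ** g = g ** diagmat \<mu>"
proof -
  have "\<exists>u. u \<noteq> 0 \<and> X *v u = \<mu> i *s u" for i
  proof -
    let ?M = "(\<chi> k j. (if k = j then \<mu> i else 0) - X $ k $ j) :: complex^'n^'n"
    have "det ?M = 0"
      using root[of i] by (simp add: poly_charpoly)
    then have "\<not> invertible ?M"
      by (simp add: invertible_det_nz)
    then obtain u where "u \<noteq> 0" "?M *v u = 0"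
      by (auto simp: invertible_iff_ker)
    moreover have "?M = diagmat (\<lambda>k. \<mu> i) - X"
      by (simp add: vec_eq_iff)
    ultimately have "diagmat (\<lambda>k. \<mu> i) *v u - X *v u = 0"
      by (simp flip: matrix_vector_mult_diff_rdistrib)
    moreover have "diagmat (\<lambda>k. \<mu> i) *v u = \<mu> i *s u"
      by (simp add: vec_eq_iff)
    ultimately have "X *v u = \<mu> i *s u" by simp
    with \<open>u \<noteq> 0\<close> show ?thesis by blast
  qed
  then obtain u where u: "\<And>i. u i \<noteq> 0" "\<And>i. X *v u i = \<mu> i *s u i" by metis
  define g :: "complex^'n^'n" where "g = (\<chi> r k. u k $ r)"
  have "X ** g = g ** diagmat \<mu>"
  proof -
    have "(X ** g) $ r $ k = (X *v u k) $ r" for r k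
      by (simp add: matrix_matrix_mult_def matrix_vector_mult_def g_def)
    then show ?thesis by (simp add: vec_eq_iff u(2)) (simp add: g_def mult.commute)
  qed
  moreover have "column i g \<noteq> 0" for i
    using u(1)[of i] by (simp add: column_def g_def)
  ultimately show ?thesis
    using distinct_eigenvectors_invertible[of X g \<mu>] \<open>inj \<mu>\<close> by auto
qed

text \<open>The absolute value of a monic polynomial at \<open>z\<close> is the product of the distances from \<open>z\<close> to
  the roots, so it is not small if all roots are far away.\<close>

lemma monic_root_near:
  fixes p :: "complex poly"
  assumes "lead_coeff p = 1" and small: "norm (poly p z) < r ^ degree p" and "r > 0"
  shows "\<exists>t. poly p t = 0 \<and> dist z t < r"
proof (rule ccontr)
  assume no: "\<not> ?thesis"
  have nz: "p \<noteq> 0" using assms(1) by auto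
  have p: "p = (\<Prod>x\<in>#proots p. [:- x, 1:])"
    using complex_poly_decompose_multiset[of p] assms(1) by simp
  have far: "r \<le> norm (z - x)" if "x \<in># proots p" for x
    using that no nz by (force simp: dist_norm not_less)
  have "r ^ size M \<le> norm (poly (\<Prod>x\<in>#M. [:- x, 1:]) z)"
    if "\<And>x. x \<in># M \<Longrightarrow> r \<le> norm (z - x)" for M
    using that
  proof (induction M)
    case (add x M)
    then have "r * r ^ size M \<le> norm (z - x) * norm (poly (\<Prod>x\<in>#M. [:- x, 1:]) z)"
      using \<open>r > 0\<close> by (intro mult_mono) auto
    moreover have "poly (\<Prod>x\<in>#add_mset x M. [:- x, 1:]) z
        = (z - x) * poly (\<Prod>x\<in>#M. [:- x, 1:]) z"
      by (simp add: algebra_simps)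
    ultimately show ?case by (simp only: norm_mult size_add_mset power_Suc)
  qed simp
  from this[of "proots p"] have "r ^ degree p \<le> norm (poly p z)"
    using far p by (metis size_proots_complex)
  then show False using small by simp
qed

text \<open>An enumeration of the matrix indices by \<open>0, \<dots>, n - 1\<close>, used for exponents.\<close>

definition idx :: "'n::finite \<Rightarrow> nat" where
  "idx = (SOME f. bij_betw f UNIV {0..<CARD('n)})"

lemma bij_betw_idx: "bij_betw (idx :: 'n \<Rightarrow> nat) UNIV {0..<CARD('n::finite)}"
  unfolding idx_def using ex_bij_betw_finite_nat[of "UNIV :: 'n set"]
  by (intro someI_ex[of "\<lambda>f. bij_betw f UNIV _"]) auto

lemma inj_idx: "inj (idx :: 'n::finite \<Rightarrow> nat)"
  using bij_betw_idx bij_betw_def by blast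

lemma idx_eq_iff [simp]: "idx i = idx j \<longleftrightarrow> i = j"
  by (rule inj_eq[OF inj_idx])

lemma idx_less: "idx (i :: 'n::finite) < CARD('n)"
  using bij_betw_idx[where 'n='n] by (auto simp: bij_betw_def)

lemma ex_idx: "k < CARD('n) \<Longrightarrow> \<exists>i :: 'n::finite. idx i = k"
proof -
  assume "k < CARD('n)"
  then have "k \<in> range (idx :: 'n \<Rightarrow> nat)"
    using bij_betw_imp_surj_on[OF bij_betw_idx[where 'n='n]] by simp
  then show ?thesis by auto
qed

lemma sum_idx: "(\<Sum>i\<in>(UNIV :: 'n::finite set). f (idx i)) = (\<Sum>k<CARD('n). f k)"
  using sum.reindex_bij_betw[OF bij_betw_idx[where 'n='n], of f]
  by (simp add: atLeast0LessThan)

text \<open>Every matrix \<open>A\<close> lies on a line through \<open>diag (0, \<dots>, n - 1)\<close>. The characteristic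
  polynomial at the integer \<open>i\<close> is small near that point of the line, so there is an eigenvalue
  within \<open>1/2\<close> of each \<open>i\<close>, hence \<open>n\<close> distinct ones.\<close>

lemma matpoly_zero_density:
  fixes A :: "complex^'n^'n"
  assumes f: "matpoly f"
    and zero: "\<And>X (g :: complex^'n^'n) \<mu>. invertible g \<Longrightarrow> inj \<mu> \<Longrightarrow> X ** g = g ** diagmat \<mu> \<Longrightarrow> f X = 0"
  shows "f A = 0"
proof -
  define D :: "complex^'n^'n" where "D = diagmat (\<lambda>i. of_nat (idx i))"
  define X where "X s = (\<chi> i j. D $ i $ j + s * (A - D) $ i $ j)" for s
  let ?n = "CARD('n)"
  let ?z = "\<lambda>i :: 'n. of_nat (idx i) :: complex"
  have diag: "\<exists>(g :: complex^'n^'n) \<mu>. invertible g \<and> inj \<mu> \<and> X s ** g = g ** diagmat \<mu>"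
    if small: "\<forall>i. norm (poly (charpoly (X s)) (?z i)) < (1/2) ^ ?n" for s
  proof -
    have "\<exists>t. poly (charpoly (X s)) t = 0 \<and> dist (?z i) t < 1/2" for i
      using charpoly_monic[of "X s"] small by (intro monic_root_near) auto
    then obtain \<mu> where \<mu>: "\<And>i. poly (charpoly (X s)) (\<mu> i) = 0"
      "\<And>i. dist (?z i) (\<mu> i) < 1/2" by metis
    have "inj \<mu>"
    proof (rule injI, rule ccontr)
      fix i j assume eq: "\<mu> i = \<mu> j" and "i \<noteq> j"
      have "dist (?z i) (?z j) < 1"
        using dist_triangle_half_l[of "?z i" "\<mu> i" 1 "?z j"] \<mu>(2)[of i] \<mu>(2)[of j] eq by simp
      moreover have "?z i - ?z j = of_int (int (idx i) - int (idx j))" by simp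
      moreover have "\<bar>int (idx i) - int (idx j)\<bar> \<ge> 1"
        using \<open>i \<noteq> j\<close> idx_eq_iff[of i j] by linarith
      ultimately show False
        by (metis dist_norm norm_of_int of_int_1_le_iff of_int_abs not_less)
    qed
    from diagonalize_distinct_eigenvalues[OF this \<mu>(1)] obtain g
      where "invertible g" "X s ** g = g ** diagmat \<mu>" by blast
    with \<open>inj \<mu>\<close> show ?thesis by blast
  qed
  have "\<exists>\<delta>>0. \<forall>s. norm s < \<delta> \<longrightarrow> norm (poly (charpoly (X s)) (?z i)) < (1/2) ^ ?n" for i
  proof -
    have "matpoly (\<lambda>A :: complex^'n^'n. poly (charpoly A) (?z i))"
      unfolding poly_altdef charpoly_monic(1)
      by (intro matpoly_sum matpoly.mult matpoly_coeff_charpoly matpoly.const)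
    from matpoly_on_line[OF this, of D "A - D"]
    obtain q where q: "\<And>s. poly (charpoly (X s)) (?z i) = poly q s"
      unfolding X_def by blast
    have "X 0 = D" by (simp add: X_def vec_eq_iff)
    then have "poly q 0 = 0"
      unfolding q[symmetric] by (auto simp: D_def charpoly_diagmat poly_prod)
    moreover have "isCont (poly q) 0" by simp
    ultimately show ?thesis
      unfolding q continuous_at_eps_delta by (force dest: spec[of _ "(1/2) ^ ?n"])
  qed
  then obtain \<delta> where \<delta>: "\<And>i. \<delta> i > 0"
    "\<And>i s. norm s < \<delta> i \<Longrightarrow> norm (poly (charpoly (X s)) (?z i)) < (1/2) ^ ?n" by metis
  define \<epsilon> where "\<epsilon> = Min (range \<delta>)"
  have \<epsilon>: "\<epsilon> > 0" "\<And>i. \<epsilon> \<le> \<delta> i"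
    by (simp_all add: \<epsilon>_def \<delta>)
  obtain q where q: "\<And>s. f (X s) = poly q s"
    using matpoly_on_line[OF f, of D "A - D"] unfolding X_def by blast
  have "poly q s = 0" if "norm s < \<epsilon>" for s
    using diag[of s] \<delta>(2)[of s] \<epsilon>(2) that zero q by (metis less_le_trans)
  then have "ball 0 \<epsilon> \<subseteq> {s. poly q s = 0}" by auto
  moreover have "infinite (ball (0 :: complex) \<epsilon>)"
    using \<epsilon>(1) uncountable_ball countable_finite by blast
  ultimately have "q = 0"
    using poly_roots_finite finite_subset by blast
  moreover have "X 1 = A" by (simp add: X_def vec_eq_iff)
  ultimately show ?thesis using q[of 1] by simp
qed

section \<open>Equivariant polynomial families of operators\<close>

lemma mscale_nth [simp]: "mscale c A $ i $ j = c * A $ i $ j"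
  by (simp add: mscale_def)

lemma mscale_mult_left: "mscale c A ** B = mscale c (A ** B)"
  by (simp add: vec_eq_iff matrix_matrix_mult_def sum_distrib_left mult.assoc)

lemma mscale_mult_right: "A ** mscale c B = mscale c (A ** B)"
  by (simp add: vec_eq_iff matrix_matrix_mult_def sum_distrib_left mult.left_commute)

lemma trace_mscale: "trace (mscale c A) = c * trace A"
  by (simp add: trace_def sum_distrib_left)

lemma matrix_add_rdistrib: "(A + B) ** C = A ** C + B ** C"
  for A :: "'r::semiring_1^'n^'m"
  by (simp add: vec_eq_iff matrix_matrix_mult_def sum.distrib distrib_right)

lemma matrix_sum_left: "(\<Sum>i\<in>I. f i) ** A = (\<Sum>i\<in>I. f i ** A)"
  for A :: "'r::semiring_1^'n^'m"
  by (induction I rule: infinite_finite_induct) (simp_all add: matrix_add_rdistrib)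

lemma matrix_sum_right: "A ** (\<Sum>i\<in>I. f i) = (\<Sum>i\<in>I. A ** f i)"
  for A :: "'r::semiring_1^'n^'m"
  by (induction I rule: infinite_finite_induct) (simp_all add: matrix_add_ldistrib)

definition munit :: "'n \<Rightarrow> 'n \<Rightarrow> complex^'n^'n" where
  "munit k l = (\<chi> i j. if i = k \<and> j = l then 1 else 0)"

lemma munit_nth [simp]: "munit k l $ i $ j = (if i = k \<and> j = l then 1 else 0)"
  by (simp add: munit_def)

lemma matrix_expand: "Y = (\<Sum>k\<in>UNIV. \<Sum>l\<in>UNIV. mscale (Y $ k $ l) (munit k l))"
proof -
  have "(\<Sum>k\<in>UNIV. \<Sum>l\<in>UNIV. Y $ k $ l * (if i = k \<and> j = l then 1 else 0))
      = (\<Sum>k\<in>UNIV. if i = k then Y $ k $ j else 0)" for i j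
    by (rule sum.cong) (auto simp: if_distrib cong: if_cong)
  then show ?thesis by (simp add: vec_eq_iff)
qed

lemma munit_mult_nth [simp]: "(munit k l ** A) $ i $ j = (if i = k then A $ l $ j else 0)"
  by (simp add: matrix_matrix_mult_def if_distrib if_distribR cong: if_cong)

lemma mult_munit_nth [simp]: "(A ** munit k l) $ i $ j = (if j = l then A $ i $ k else 0)"
  by (simp add: matrix_matrix_mult_def if_distrib if_distribR cong: if_cong)

lemma invertible_cancel_right:
  fixes A B g :: "complex^'n^'n"
  assumes "invertible g" "A ** g = B ** g"
  shows "A = B"
proof -
  obtain h where "g ** h = mat 1" using assms(1) unfolding invertible_def by blast
  then show ?thesis using assms(2) by (metis matrix_mul_assoc matrix_mul_rid)
qed

lemma invertible_cancel_left:
  fixes A B g :: "complex^'n^'n"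
  assumes "invertible g" "g ** A = g ** B"
  shows "A = B"
proof -
  obtain h where "h ** g = mat 1" using assms(1) unfolding invertible_def by blast
  then show ?thesis using assms(2) by (metis matrix_mul_assoc matrix_mul_lid)
qed

text \<open>Conjugation by \<open>g\<close> is expressed by intertwining: \<open>A' g = g A\<close> says \<open>A' = g A g\<^sup>-\<^sup>1\<close>.\<close>

definition equivariant :: "(complex^'n^'n \<Rightarrow> complex^'n^'n \<Rightarrow> complex^'n^'n) \<Rightarrow> bool" where
  "equivariant T \<longleftrightarrow> (\<forall>g A A' Y Y'. invertible g \<longrightarrow> A' ** g = g ** A \<longrightarrow> Y' ** g = g ** Y
      \<longrightarrow> T A' Y' ** g = g ** T A Y)"

definition linear_family :: "(complex^'n^'n \<Rightarrow> complex^'n^'n \<Rightarrow> complex^'n^'n) \<Rightarrow> bool" where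
  "linear_family T \<longleftrightarrow> (\<forall>A c Y Z. T A (mscale c Y + Z) = mscale c (T A Y) + T A Z)"

definition covariant :: "(complex^'n^'n \<Rightarrow> complex^'n^'n \<Rightarrow> complex^'n^'n) \<Rightarrow> bool" where
  "covariant T \<longleftrightarrow> equivariant T \<and> linear_family T \<and> (\<forall>Y i j. matpoly (\<lambda>A. T A Y $ i $ j))"

definition invariant_fun :: "(complex^'n^'n \<Rightarrow> complex) \<Rightarrow> bool" where
  "invariant_fun f \<longleftrightarrow> matpoly f \<and>
     (\<forall>(g :: complex^'n^'n) A A'. invertible g \<longrightarrow> A' ** g = g ** A \<longrightarrow> f A' = f A)"

lemma equivariantD:
  "equivariant T \<Longrightarrow> invertible g \<Longrightarrow> A' ** g = g ** A \<Longrightarrow> Y' ** g = g ** Y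
    \<Longrightarrow> T A' Y' ** g = g ** T A Y"
  by (simp add: equivariant_def)

lemma linear_family_add:
  assumes "linear_family T"
  shows "T A (Y + Z) = T A Y + T A Z"
proof -
  have "mscale 1 Y = Y" for Y :: "complex^'n^'n" by (simp add: vec_eq_iff)
  then show ?thesis using assms unfolding linear_family_def by metis
qed

lemma linear_family_0:
  assumes "linear_family T"
  shows "T A 0 = 0"
  using linear_family_add[OF assms, of A 0 0] by simp

lemma linear_family_mscale:
  assumes "linear_family T"
  shows "T A (mscale c Y) = mscale c (T A Y)"
  using assms linear_family_0[OF assms, of A] unfolding linear_family_def
  by (metis add.right_neutral)

lemma linear_family_sum:
  assumes "linear_family T"
  shows "T A (\<Sum>i\<in>I. f i) = (\<Sum>i\<in>I. T A (f i))"
  by (induction I rule: infinite_finite_induct)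
    (simp_all add: linear_family_0[OF assms] linear_family_add[OF assms])

lemma linear_family_expand:
  assumes "linear_family T"
  shows "T A Y = (\<Sum>k\<in>UNIV. \<Sum>l\<in>UNIV. mscale (Y $ k $ l) (T A (munit k l)))"
proof -
  have "T A Y = T A (\<Sum>k\<in>UNIV. \<Sum>l\<in>UNIV. mscale (Y $ k $ l) (munit k l))"
    by (simp flip: matrix_expand)
  then show ?thesis
    by (simp add: linear_family_sum[OF assms] linear_family_mscale[OF assms])
qed

lemma linear_family_expand_nth:
  assumes "linear_family T"
  shows "T A Y $ i $ j = (\<Sum>k\<in>UNIV. \<Sum>l\<in>UNIV. Y $ k $ l * T A (munit k l) $ i $ j)"
  by (subst linear_family_expand[OF assms]) simp

lemma covariant_add:
  assumes "covariant T" "covariant T'"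
  shows "covariant (\<lambda>A Y. T A Y + T' A Y)"
  using assms
  by (auto simp: covariant_def equivariant_def linear_family_def matrix_add_ldistrib
      matrix_add_rdistrib mvs.scale_right_distrib intro: matpoly.add)

lemma covariant_scale:
  assumes "covariant T" "invariant_fun f"
  shows "covariant (\<lambda>A Y. mscale (f A) (T A Y))"
proof -
  have "mscale (f A') (T A' Y') ** g = g ** mscale (f A) (T A Y)"
    if "invertible g" "A' ** g = g ** A" "Y' ** g = g ** Y" for g A A' Y Y'
  proof -
    have "f A' = f A" using assms(2) that unfolding invariant_fun_def by blast
    moreover have "T A' Y' ** g = g ** T A Y"
      using assms(1) that unfolding covariant_def equivariant_def by blast
    ultimately show ?thesis by (simp add: mscale_mult_left mscale_mult_right)
  qed
  then show ?thesis
    using assms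
    by (auto simp: covariant_def equivariant_def linear_family_def invariant_fun_def
        mvs.scale_right_distrib mult.commute intro: matpoly.mult)
qed

lemma covariant_0: "covariant (\<lambda>A Y. 0)"
  by (simp add: covariant_def equivariant_def linear_family_def matpoly.const)

lemma covariant_sum:
  "(\<And>i. i \<in> I \<Longrightarrow> covariant (T i)) \<Longrightarrow> covariant (\<lambda>A Y. \<Sum>i\<in>I. T i A Y)"
  by (induction I rule: infinite_finite_induct) (simp_all add: covariant_0 covariant_add)

lemma invariant_fun_const: "invariant_fun (\<lambda>A. c)"
  by (simp add: invariant_fun_def matpoly.const)

lemma covariant_diff:
  assumes "covariant T" "covariant T'"
  shows "covariant (\<lambda>A Y. T A Y - T' A Y)"
proof -
  have "mscale (-1) Z = - Z" for Z :: "complex^'n^'n" by (simp add: vec_eq_iff)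
  then show ?thesis
    using covariant_add[OF assms(1) covariant_scale[OF assms(2) invariant_fun_const[of "-1"]]]
    by simp
qed

definition sandwich :: "nat \<Rightarrow> nat \<Rightarrow> complex^'n^'n \<Rightarrow> complex^'n^'n \<Rightarrow> complex^'n^'n" where
  "sandwich k l A Y = mpow A k ** Y ** mpow A l"

definition dyad :: "nat \<Rightarrow> nat \<Rightarrow> complex^'n^'n \<Rightarrow> complex^'n^'n \<Rightarrow> complex^'n^'n" where
  "dyad k l A Y = mscale (trace (mpow A l ** Y)) (mpow A k)"

lemma covariant_sandwich: "covariant (sandwich k l)"
proof -
  have "sandwich k l A' Y' ** g = g ** sandwich k l A Y"
    if "A' ** g = g ** A" "Y' ** g = g ** Y" for g A A' Y Y' :: "complex^'n^'n"
  proof -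
    have "sandwich k l A' Y' ** g = mpow A' k ** (Y' ** (mpow A' l ** g))"
      by (simp add: sandwich_def matrix_mul_assoc)
    also have "\<dots> = mpow A' k ** (Y' ** g) ** mpow A l"
      unfolding mpow_intertwine[OF that(1)] by (simp add: matrix_mul_assoc)
    also have "\<dots> = mpow A' k ** g ** Y ** mpow A l"
      unfolding that(2) by (simp add: matrix_mul_assoc)
    also have "\<dots> = g ** sandwich k l A Y"
      unfolding mpow_intertwine[OF that(1)] by (simp add: sandwich_def matrix_mul_assoc)
    finally show ?thesis .
  qed
  moreover have "matpoly (\<lambda>A. sandwich k l A Y $ i $ j)" for Y :: "complex^'n^'n" and i j
    unfolding sandwich_def by (intro matpoly_mat_mult matpoly_mpow matpoly.const)
  ultimately show ?thesis
    by (auto simp: covariant_def equivariant_def linear_family_def sandwich_def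
        matrix_add_ldistrib matrix_add_rdistrib mscale_mult_left mscale_mult_right)
qed

lemma covariant_dyad: "covariant (dyad k l)"
proof -
  have "dyad k l A' Y' ** g = g ** dyad k l A Y"
    if "invertible g" "A' ** g = g ** A" "Y' ** g = g ** Y" for g A A' Y Y' :: "complex^'n^'n"
  proof -
    have "mpow A' l ** Y' ** g = mpow A' l ** g ** Y"
      using that(3) by (simp flip: matrix_mul_assoc)
    also have "\<dots> = g ** (mpow A l ** Y)"
      unfolding mpow_intertwine[OF that(2)] by (simp add: matrix_mul_assoc)
    finally have "trace (mpow A' l ** Y') = trace (mpow A l ** Y)"
      using trace_intertwine that(1) by blast
    then show ?thesis
      by (simp add: dyad_def mscale_mult_left mscale_mult_right mpow_intertwine[OF that(2)])
  qed
  moreover have "matpoly (\<lambda>A. dyad k l A Y $ i $ j)" for Y :: "complex^'n^'n" and i j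
    unfolding dyad_def mscale_nth
    by (intro matpoly_mat_mult matpoly_mpow matpoly.const matpoly.mult matpoly_trace)
  ultimately show ?thesis
    by (auto simp: covariant_def equivariant_def linear_family_def dyad_def
        matrix_add_ldistrib mscale_mult_right trace_add trace_mscale mvs.scale_left_distrib)
qed

lemma invariant_fun_trace_mpow: "invariant_fun (\<lambda>A :: complex^'n^'n. c * trace (mpow A k))"
  unfolding invariant_fun_def
proof (intro conjI allI impI)
  show "matpoly (\<lambda>A :: complex^'n^'n. c * trace (mpow A k))"
    by (intro matpoly.mult matpoly.const matpoly_trace matpoly_mpow)
  show "c * trace (mpow A' k) = c * trace (mpow A k)"
    if "invertible g" "A' ** g = g ** A" for g A A' :: "complex^'n^'n"
    using trace_intertwine[OF that(1) mpow_intertwine[OF that(2)]] by simp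
qed

text \<open>Equivariance extends equality from the diagonal matrices to their conjugates, and density to all
  matrices.\<close>

lemma covariant_eq_if_eq_on_diagonal:
  fixes T T' :: "complex^'n^'n \<Rightarrow> complex^'n^'n \<Rightarrow> complex^'n^'n"
  assumes T: "covariant T" and T': "covariant T'"
    and eq: "\<And>\<mu> i j a b. inj \<mu> \<Longrightarrow>
      T (diagmat \<mu>) (munit i j) $ a $ b = T' (diagmat \<mu>) (munit i j) $ a $ b"
  shows "T A Y = T' A Y"
proof -
  have "T A Y $ a $ b - T' A Y $ a $ b = 0" for a b
  proof (rule matpoly_zero_density[of "\<lambda>A. T A Y $ a $ b - T' A Y $ a $ b"])
    show "matpoly (\<lambda>A. T A Y $ a $ b - T' A Y $ a $ b)"
      using T T' by (auto simp: covariant_def intro: matpoly_diff)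
    fix X g :: "complex^'n^'n" and \<mu> :: "'n \<Rightarrow> complex"
    assume g: "invertible g" and "inj \<mu>" and X: "X ** g = g ** diagmat \<mu>"
    obtain h where h: "g ** h = mat 1" using g unfolding invertible_def by blast
    have lin: "linear_family T" "linear_family T'"
      using T T' by (auto simp: covariant_def)
    have "T (diagmat \<mu>) (munit i j) = T' (diagmat \<mu>) (munit i j)" for i j
      using eq[OF \<open>inj \<mu>\<close>] by (simp add: vec_eq_iff)
    then have diag: "T (diagmat \<mu>) Z = T' (diagmat \<mu>) Z" for Z
      using linear_family_expand[OF lin(1), of "diagmat \<mu>" Z]
        linear_family_expand[OF lin(2), of "diagmat \<mu>" Z] by simp
    have Y: "Y ** g = g ** (h ** Y ** g)"
      using h by (simp add: matrix_mul_assoc)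
    have "T X Y ** g = T' X Y ** g"
      using equivariantD[OF _ g X Y, of T] equivariantD[OF _ g X Y, of T'] T T' diag
      by (simp add: covariant_def)
    then show "T X Y $ a $ b - T' X Y $ a $ b = 0"
      using invertible_cancel_right[OF g, of "T X Y" "T' X Y"] by simp
  qed
  then show ?thesis by (simp add: vec_eq_iff)
qed

text \<open>Conjugation by \<open>diag(d)\<close> fixes \<open>diag(\<mu>)\<close>, scales \<open>E\<^sub>k\<^sub>l\<close> by \<open>d\<^sub>k / d\<^sub>l\<close> and the entry \<open>(i, j)\<close> of
  the image by \<open>d\<^sub>i / d\<^sub>j\<close>. So that entry vanishes unless \<open>d\<^sub>k d\<^sub>j = d\<^sub>i d\<^sub>l\<close> for all \<open>d\<close>; to exclude all
  other positions, a single entry \<open>2\<close> of \<open>d\<close>, placed at \<open>i\<close> or at \<open>l\<close>, is enough.\<close>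

lemma torus_weights:
  assumes "covariant T" and "\<not> (i = k \<and> j = l)" and "\<not> (i = j \<and> k = l)"
  shows "T (diagmat \<mu>) (munit k l) $ i $ j = 0"
proof -
  let ?t = "T (diagmat \<mu>) (munit k l) $ i $ j"
  have lin: "linear_family T" and equi: "equivariant T"
    using assms(1) by (auto simp: covariant_def)
  have weight: "d k * d j * ?t = d i * d l * ?t" if nz: "\<forall>m. d m \<noteq> 0" for d :: "'a \<Rightarrow> complex"
  proof -
    have "diagmat d ** diagmat (\<lambda>m. inverse (d m)) = mat 1"
      using nz by (simp add: vec_eq_iff mat_def)
    then have "invertible (diagmat d)"
      using invertible_right_inverse by blast
    moreover have "diagmat \<mu> ** diagmat d = diagmat d ** diagmat \<mu>"
      by (simp add: vec_eq_iff)
    moreover have "mscale (d k / d l) (munit k l) ** diagmat d = diagmat d ** munit k l"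
      using nz by (simp add: vec_eq_iff)
    ultimately have "T (diagmat \<mu>) (mscale (d k / d l) (munit k l)) ** diagmat d
        = diagmat d ** T (diagmat \<mu>) (munit k l)"
      by (rule equivariantD[OF equi])
    then have "(d k / d l) * ?t * d j = d i * ?t"
      unfolding linear_family_mscale[OF lin] by (metis mult_diagmat_nth diagmat_mult_nth mscale_nth)
    then show ?thesis using nz by (simp add: field_simps)
  qed
  have "(if k = m then 2 else 1) * (if j = m then 2 else 1) * ?t
      = (if i = m then 2 else 1) * (if l = m then 2 else 1) * ?t" for m
    by (rule weight) auto
  from this[of i] this[of l] show ?thesis
    using assms(2,3) by (auto split: if_splits)
qed

section \<open>The companion matrix as a section of the characteristic polynomial\<close>

definition zero_ix :: "'n::finite" where
  "zero_ix = (SOME i. idx i = 0)"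

definition last_ix :: "'n::finite" where
  "last_ix = (SOME i :: 'n. Suc (idx i) = CARD('n))"

lemma idx_zero_ix: "idx (zero_ix :: 'n::finite) = 0"
  unfolding zero_ix_def using ex_idx[of 0, where 'n='n] by (rule someI_ex) simp

lemma idx_last_ix: "Suc (idx (last_ix :: 'n::finite)) = CARD('n)"
proof -
  obtain m where m: "CARD('n) = Suc m"
    by (metis Suc_pred zero_less_card_finite)
  then obtain i :: 'n where "idx i = m" using ex_idx[of m, where 'n='n] by auto
  then have "\<exists>i :: 'n. Suc (idx i) = CARD('n)" using m by auto
  then show ?thesis unfolding last_ix_def by (rule someI_ex)
qed

text \<open>Each conjugacy class with distinct eigenvalues is represented by a matrix whose entries are
  polynomials in the coefficients of the characteristic polynomial.\<close>

definition companion :: "complex^'n^'n \<Rightarrow> complex^'n^'n" where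
  "companion A = (\<chi> i j. (if idx i = Suc (idx j) then 1 else 0)
      - (if j = last_ix then coeff (charpoly A) (idx i) else 0))"

text \<open>The Hankel matrix of the coefficients of the characteristic polynomial \<open>\<chi>\<close>. It is the matrix
  of the Bezoutian \<open>(\<chi>(s) - \<chi>(t)) / (s - t)\<close>.\<close>

definition hankel :: "complex^'n^'n \<Rightarrow> 'n \<Rightarrow> 'n \<Rightarrow> complex" where
  "hankel A k l = coeff (charpoly A) (Suc (idx k + idx l))"

definition bezoutian :: "complex^'n^'n \<Rightarrow> complex \<Rightarrow> complex \<Rightarrow> complex" where
  "bezoutian A s t = (\<Sum>k\<in>UNIV. \<Sum>l\<in>UNIV. hankel A k l * s ^ idx k * t ^ idx l)"

lemma bezoutian_eq:
  fixes A :: "complex^'n^'n"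
  shows "poly (charpoly A) s - poly (charpoly A) t = (s - t) * bezoutian A s t"
proof -
  let ?n = "CARD('n)" and ?c = "coeff (charpoly A)"
  have "(\<Sum>l<?n. ?c (Suc (k + l)) * s ^ k * t ^ l) = (\<Sum>l<?n - k. ?c (k + l + 1) * t ^ l * s ^ k)"
    for k
  proof (rule sum.mono_neutral_cong_right)
    show "\<forall>l\<in>{..<?n} - {..<?n - k}. ?c (Suc (k + l)) * s ^ k * t ^ l = 0"
      by (auto simp: charpoly_monic(1) intro!: coeff_eq_0)
  qed (auto simp: mult_ac)
  moreover have "bezoutian A s t = (\<Sum>k<?n. \<Sum>l<?n. ?c (Suc (k + l)) * s ^ k * t ^ l)"
  proof -
    have "(\<Sum>l\<in>(UNIV :: 'n set). ?c (Suc (k + idx l)) * s ^ k * t ^ idx l)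
        = (\<Sum>l<?n. ?c (Suc (k + l)) * s ^ k * t ^ l)" for k
      by (rule sum_idx[where f="\<lambda>l. ?c (Suc (k + l)) * s ^ k * t ^ l"])
    then have "bezoutian A s t
        = (\<Sum>k\<in>(UNIV :: 'n set). \<Sum>l<?n. ?c (Suc (idx k + l)) * s ^ idx k * t ^ l)"
      by (simp only: bezoutian_def hankel_def)
    also have "\<dots> = (\<Sum>k<?n. \<Sum>l<?n. ?c (Suc (k + l)) * s ^ k * t ^ l)"
      by (rule sum_idx[where f="\<lambda>k. \<Sum>l<?n. ?c (Suc (k + l)) * s ^ k * t ^ l"])
    finally show ?thesis .
  qed
  ultimately show ?thesis
    using polyfun_diff_alt[of ?n ?c s t] zero_less_card_finite[where 'a='n]
    by (simp add: poly_altdef charpoly_monic(1))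
qed

definition vandermonde :: "('n::finite \<Rightarrow> complex) \<Rightarrow> complex^'n^'n" where
  "vandermonde \<mu> = (\<chi> i j. \<mu> i ^ idx j)"

text \<open>For distinct \<open>\<mu>\<^sub>i\<close>, the columns are right eigenvectors of the companion matrix; their entries are
  the truncated Horner values of the characteristic polynomial. The left eigenvectors are the rows of
  \<^const>\<open>vandermonde\<close>.\<close>

definition horner_matrix :: "('n::finite \<Rightarrow> complex) \<Rightarrow> complex^'n^'n" where
  "horner_matrix \<mu> = (\<chi> k i. \<Sum>l\<in>UNIV. hankel (diagmat \<mu>) k l * \<mu> i ^ idx l)"

lemma poly_charpoly_diagmat: "poly (charpoly (diagmat \<mu>)) (\<mu> i) = 0"
  by (auto simp: charpoly_diagmat poly_prod)

lemma bezoutian_diagmat: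
  fixes \<mu> :: "'n::finite \<Rightarrow> complex"
  assumes "inj \<mu>"
  shows "bezoutian (diagmat \<mu>) (\<mu> i) (\<mu> j) = 0 \<longleftrightarrow> i \<noteq> j"
proof (cases "i = j")
  case False
  then have "\<mu> i - \<mu> j \<noteq> 0" using assms by (simp add: inj_eq)
  then show ?thesis
    using bezoutian_eq[of "diagmat \<mu>" "\<mu> i" "\<mu> j"] False by (simp add: poly_charpoly_diagmat)
next
  case True
  \<comment> \<open>As a polynomial in \<open>s\<close>, the Bezoutian at \<open>t = \<mu>\<^sub>i\<close> is the product of the other root factors.\<close>
  let ?b = "\<Sum>k\<in>UNIV. monom (\<Sum>l\<in>UNIV. hankel (diagmat \<mu>) k l * \<mu> i ^ idx l) (idx k)"
  have b: "poly ?b s = bezoutian (diagmat \<mu>) s (\<mu> i)" for s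
    by (simp add: bezoutian_def poly_sum poly_monom sum_distrib_left mult_ac)
  have "poly ([:- \<mu> i, 1:] * ?b) s = poly (charpoly (diagmat \<mu>)) s" for s
    unfolding poly_mult b
    using bezoutian_eq[of "diagmat \<mu>" s "\<mu> i"] by (simp add: poly_charpoly_diagmat)
  then have "[:- \<mu> i, 1:] * ?b = charpoly (diagmat \<mu>)"
    by (simp add: fun_eq_iff flip: poly_eq_poly_eq_iff)
  also have "\<dots> = [:- \<mu> i, 1:] * (\<Prod>j\<in>UNIV - {i}. [:- \<mu> j, 1:])"
    unfolding charpoly_diagmat by (rule prod.remove) simp_all
  finally have "?b = (\<Prod>j\<in>UNIV - {i}. [:- \<mu> j, 1:])"
    by (subst (asm) mult_cancel_left) simp
  then have "bezoutian (diagmat \<mu>) (\<mu> i) (\<mu> i) = (\<Prod>j\<in>UNIV - {i}. \<mu> i - \<mu> j)"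
    unfolding b[symmetric] by (simp add: poly_prod)
  also have "\<dots> \<noteq> 0" using assms by (auto simp: inj_eq)
  finally show ?thesis using True by simp
qed

text \<open>The value of the Bezoutian on the diagonal is the derivative \<open>\<chi>'(\<mu>\<^sub>i)\<close> of the characteristic
  polynomial.\<close>

definition bezoutian_diag :: "('n::finite \<Rightarrow> complex) \<Rightarrow> 'n \<Rightarrow> complex" where
  "bezoutian_diag \<mu> i = bezoutian (diagmat \<mu>) (\<mu> i) (\<mu> i)"

lemma vandermonde_horner:
  assumes "inj \<mu>"
  shows "vandermonde \<mu> ** horner_matrix \<mu> = diagmat (bezoutian_diag \<mu>)"
proof -
  have "(vandermonde \<mu> ** horner_matrix \<mu>) $ i $ j = bezoutian (diagmat \<mu>) (\<mu> i) (\<mu> j)" for i j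
    by (simp add: vandermonde_def horner_matrix_def matrix_matrix_mult_def bezoutian_def
        sum_distrib_left mult_ac)
  then show ?thesis
    using bezoutian_diagmat[OF assms] by (simp add: vec_eq_iff bezoutian_diag_def)
qed

lemma invertible_vandermonde:
  assumes "inj \<mu>"
  shows "invertible (vandermonde \<mu>)"
proof -
  have "vandermonde \<mu> ** (horner_matrix \<mu> ** diagmat (\<lambda>i. inverse (bezoutian_diag \<mu> i))) = mat 1"
    unfolding matrix_mul_assoc vandermonde_horner[OF assms]
    using bezoutian_diagmat[OF assms] by (simp add: vec_eq_iff mat_def bezoutian_diag_def)
  then show ?thesis using invertible_right_inverse by blast
qed

lemma vandermonde_companion:
  fixes \<mu> :: "'n::finite \<Rightarrow> complex"
  shows "diagmat \<mu> ** vandermonde \<mu> = vandermonde \<mu> ** companion (diagmat \<mu>)"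
proof -
  let ?n = "CARD('n)" and ?c = "coeff (charpoly (diagmat \<mu>))"
  have "\<mu> i ^ Suc (idx j) = (\<Sum>k\<in>UNIV. \<mu> i ^ idx k * companion (diagmat \<mu>) $ k $ j)" for i j
  proof (cases "j = last_ix")
    case False
    have "Suc (idx j) \<noteq> ?n"
      using False idx_eq_iff idx_last_ix by (metis nat.inject)
    then obtain j' :: 'n where j': "idx j' = Suc (idx j)"
      using ex_idx[of "Suc (idx j)", where 'n='n] idx_less[of j] by auto
    have "(\<Sum>k\<in>UNIV. \<mu> i ^ idx k * companion (diagmat \<mu>) $ k $ j)
        = (\<Sum>k\<in>UNIV. if k = j' then \<mu> i ^ idx k else 0)"
      using False by (intro sum.cong) (auto simp: companion_def simp flip: j')
    then show ?thesis using j' by simp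
  next
    case True
    have "companion (diagmat \<mu>) $ k $ j = - ?c (idx k)" for k
      using idx_less[of k] idx_last_ix[where 'n='n] True by (simp add: companion_def)
    then have "(\<Sum>k\<in>UNIV. \<mu> i ^ idx k * companion (diagmat \<mu>) $ k $ j)
        = - (\<Sum>k\<in>(UNIV :: 'n set). ?c (idx k) * \<mu> i ^ idx k)"
      by (simp add: sum_negf mult.commute)
    also have "\<dots> = - (\<Sum>k<?n. ?c k * \<mu> i ^ k)"
      using sum_idx[of "\<lambda>k. ?c k * \<mu> i ^ k", where 'n='n] by simp
    also have "\<dots> = \<mu> i ^ ?n"
    proof -
      have "0 = (\<Sum>k\<le>?n. ?c k * \<mu> i ^ k)"
        using poly_charpoly_diagmat[of \<mu> i] by (simp add: poly_altdef charpoly_monic(1))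
      also have "\<dots> = (\<Sum>k<?n. ?c k * \<mu> i ^ k) + \<mu> i ^ ?n"
        using charpoly_monic[of "diagmat \<mu>"] by (simp flip: lessThan_Suc_atMost)
      finally show ?thesis by (simp add: eq_neg_iff_add_eq_0 neg_eq_iff_add_eq_0)
    qed
    finally show ?thesis using True idx_last_ix[where 'n='n] by simp
  qed
  then show ?thesis
    by (simp add: vec_eq_iff) (simp add: vandermonde_def matrix_matrix_mult_def)
qed

lemma horner_last_ix:
  fixes \<mu> :: "'n::finite \<Rightarrow> complex"
  shows "horner_matrix \<mu> $ last_ix $ i = 1"
proof -
  have top: "hankel (diagmat \<mu>) last_ix l = (if l = zero_ix then 1 else 0)" for l
  proof (cases "l = zero_ix")
    case True
    then show ?thesis
      using charpoly_monic[of "diagmat \<mu>"]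
      by (simp add: hankel_def idx_zero_ix idx_last_ix)
  next
    case False
    then have "idx l \<noteq> 0" using idx_zero_ix idx_eq_iff by metis
    then have "CARD('n) < Suc (idx (last_ix :: 'n) + idx l)"
      using idx_last_ix[where 'n='n] by simp
    then show ?thesis
      using False charpoly_monic(1)[of "diagmat \<mu>"] by (simp add: hankel_def coeff_eq_0)
  qed
  have "(\<Sum>l\<in>UNIV. hankel (diagmat \<mu>) last_ix l * \<mu> i ^ idx l)
      = (\<Sum>l\<in>(UNIV :: 'n set). if l = zero_ix then \<mu> i ^ idx l else 0)"
    by (rule sum.cong) (simp_all add: top)
  then show ?thesis by (simp add: horner_matrix_def idx_zero_ix)
qed

lemma matpoly_companion: "matpoly (\<lambda>A. companion A $ i $ j)"
  unfolding companion_def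
  by (cases "j = last_ix") (simp_all add: matpoly_diff matpoly.const matpoly_coeff_charpoly)

lemma matpoly_hankel: "matpoly (\<lambda>A. hankel A k l)"
  unfolding hankel_def by (rule matpoly_coeff_charpoly)

lemma invariant_fun_charpoly:
  assumes "matpoly f" and "\<And>A A'. charpoly A' = charpoly A \<Longrightarrow> f A' = f A"
  shows "invariant_fun f"
  using assms charpoly_intertwine unfolding invariant_fun_def by blast

section \<open>Every equivariant family is a combination of words\<close>

text \<open>The coefficients of the two polynomials whose values at \<open>(\<mu>\<^sub>i, \<mu>\<^sub>j)\<close> are \<open>p\<^sub>i\<^sub>j\<close> and \<open>m\<^sub>i\<^sub>j\<close>, where
  \<open>T(E\<^sub>i\<^sub>j) = p\<^sub>i\<^sub>j E\<^sub>i\<^sub>j\<close> for \<open>i \<noteq> j\<close> and \<open>T(E\<^sub>j\<^sub>j) = \<Sum>\<^sub>i m\<^sub>i\<^sub>j E\<^sub>i\<^sub>i\<close> at \<open>diag(\<mu>)\<close>; the second one is meant for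
  families with \<open>p\<^sub>i\<^sub>j = 0\<close>. They depend on \<open>A\<close> only through its characteristic polynomial.\<close>

definition offdiag_coeff ::
    "(complex^'n^'n \<Rightarrow> complex^'n^'n \<Rightarrow> complex^'n^'n) \<Rightarrow> 'n \<Rightarrow> 'n \<Rightarrow> complex^'n^'n \<Rightarrow> complex" where
  "offdiag_coeff T k l A =
    (\<Sum>a\<in>UNIV. hankel A a k * T (companion A) (munit a l) $ last_ix $ zero_ix)"

definition diag_coeff ::
    "(complex^'n^'n \<Rightarrow> complex^'n^'n \<Rightarrow> complex^'n^'n) \<Rightarrow> 'n \<Rightarrow> 'n \<Rightarrow> complex^'n^'n \<Rightarrow> complex" where
  "diag_coeff T k l A = (\<Sum>a\<in>UNIV. \<Sum>b\<in>UNIV. hankel A k a * hankel A l b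
      * T (companion A) (munit b last_ix) $ last_ix $ a)"

lemma companion_cong: "charpoly A' = charpoly A \<Longrightarrow> companion A' = companion A"
  by (simp add: companion_def vec_eq_iff)

lemma hankel_cong: "charpoly A' = charpoly A \<Longrightarrow> hankel A' = hankel A"
  by (simp add: hankel_def fun_eq_iff)

lemma matpoly_at_companion:
  assumes "covariant T"
  shows "matpoly (\<lambda>A. T (companion A) Y $ i $ j)"
  using assms by (auto simp: covariant_def intro: matpoly_compose matpoly_companion)

lemma invariant_fun_offdiag_coeff:
  assumes "covariant T"
  shows "invariant_fun (offdiag_coeff T k l)"
proof (rule invariant_fun_charpoly)
  show "matpoly (offdiag_coeff T k l)"
    unfolding offdiag_coeff_def
    by (intro matpoly_sum matpoly.mult matpoly_hankel matpoly_at_companion assms)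
qed (simp add: offdiag_coeff_def cong: companion_cong hankel_cong)

lemma invariant_fun_diag_coeff:
  assumes "covariant T"
  shows "invariant_fun (diag_coeff T k l)"
proof (rule invariant_fun_charpoly)
  show "matpoly (diag_coeff T k l)"
    unfolding diag_coeff_def
    by (intro matpoly_sum matpoly.mult matpoly_hankel matpoly_at_companion assms)
qed (simp add: diag_coeff_def cong: companion_cong hankel_cong)

text \<open>The product of the right eigenvector of the companion matrix for \<open>\<mu>\<^sub>i\<close> and the left one for
  \<open>\<mu>\<^sub>j\<close> is conjugate to a multiple of \<open>E\<^sub>i\<^sub>j\<close>, so \<open>T\<close> multiplies it by \<open>p\<^sub>i\<^sub>j\<close>. One of its entries is \<open>1\<close>.\<close>

lemma offdiag_coeff_eigenvalue:
  fixes T :: "complex^'n^'n \<Rightarrow> complex^'n^'n \<Rightarrow> complex^'n^'n"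
  assumes T: "covariant T" and \<mu>: "inj \<mu>" and "i \<noteq> j"
  shows "T (diagmat \<mu>) (munit i j) $ i $ j
    = (\<Sum>k\<in>UNIV. \<Sum>l\<in>UNIV. offdiag_coeff T k l (diagmat \<mu>) * \<mu> i ^ idx k * \<mu> j ^ idx l)"
proof -
  let ?L = "diagmat \<mu>" and ?W = "vandermonde \<mu>" and ?V = "horner_matrix \<mu>"
  let ?C = "companion ?L" and ?p = "T ?L (munit i j) $ i $ j"
  have lin: "linear_family T" and equi: "equivariant T" using T by (auto simp: covariant_def)
  define Y where "Y = (\<chi> a b. ?V $ a $ i * ?W $ j $ b)"
  have "(?W ** Y) $ r $ b = (?W ** ?V) $ r $ i * ?W $ j $ b" for r b
    by (simp add: Y_def matrix_matrix_mult_def sum_distrib_right mult.assoc)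
  then have WY: "mscale (bezoutian_diag \<mu> i) (munit i j) ** ?W = ?W ** Y"
    by (simp add: vec_eq_iff vandermonde_horner[OF \<mu>] mscale_mult_left)
  have TL: "T ?L (munit i j) = mscale ?p (munit i j)"
    using torus_weights[OF T, where k=i and l=j and \<mu>=\<mu>] \<open>i \<noteq> j\<close> by (auto simp: vec_eq_iff)
  have "T ?L (mscale (bezoutian_diag \<mu> i) (munit i j)) ** ?W = ?W ** T ?C Y"
    by (rule equivariantD[OF equi invertible_vandermonde[OF \<mu>] vandermonde_companion WY])
  moreover have "T ?L (mscale (bezoutian_diag \<mu> i) (munit i j))
      = mscale ?p (mscale (bezoutian_diag \<mu> i) (munit i j))"
    unfolding linear_family_mscale[OF lin] by (subst TL) (simp add: vec_eq_iff)
  ultimately have "?W ** mscale ?p Y = ?W ** T ?C Y"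
    by (simp only: mscale_mult_left mscale_mult_right WY[unfolded mscale_mult_left])
  then have "mscale ?p Y = T ?C Y"
    by (rule invertible_cancel_left[OF invertible_vandermonde[OF \<mu>]])
  then have "?p * Y $ last_ix $ zero_ix = T ?C Y $ last_ix $ zero_ix"
    by (metis mscale_nth)
  moreover have "Y $ last_ix $ zero_ix = 1"
    by (simp add: Y_def horner_last_ix vandermonde_def idx_zero_ix)
  ultimately have "?p = T ?C Y $ last_ix $ zero_ix" by simp
  also have "\<dots> = (\<Sum>a\<in>UNIV. \<Sum>l\<in>UNIV. \<Sum>k\<in>UNIV. hankel ?L a k * T ?C (munit a l) $ last_ix $ zero_ix
      * \<mu> i ^ idx k * \<mu> j ^ idx l)"
    by (subst linear_family_expand_nth[OF lin])
      (simp add: Y_def horner_matrix_def vandermonde_def sum_distrib_left sum_distrib_right mult_ac)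
  also have "\<dots> = (\<Sum>k\<in>UNIV. \<Sum>l\<in>UNIV. \<Sum>a\<in>UNIV. hankel ?L a k * T ?C (munit a l) $ last_ix $ zero_ix
      * \<mu> i ^ idx k * \<mu> j ^ idx l)"
    by (subst (1 2) sum.swap, subst sum.swap) (rule refl)
  finally show ?thesis
    by (simp add: offdiag_coeff_def sum_distrib_left sum_distrib_right mult_ac)
qed


lemma sum_bilinear:
  fixes p q M :: "_ \<Rightarrow> _ \<Rightarrow> 'r::comm_semiring_1"
  shows "(\<Sum>k\<in>K. \<Sum>l\<in>L. \<Sum>a\<in>A. \<Sum>b\<in>B. p k a * q l b * M a b)
    = (\<Sum>a\<in>A. \<Sum>b\<in>B. (\<Sum>k\<in>K. p k a) * (\<Sum>l\<in>L. q l b) * M a b)"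
proof -
  have "(\<Sum>k\<in>K. \<Sum>l\<in>L. \<Sum>a\<in>A. \<Sum>b\<in>B. p k a * q l b * M a b)
      = (\<Sum>k\<in>K. \<Sum>a\<in>A. \<Sum>l\<in>L. \<Sum>b\<in>B. p k a * q l b * M a b)"
    by (intro sum.cong refl sum.swap)
  also have "\<dots> = (\<Sum>a\<in>A. \<Sum>k\<in>K. \<Sum>l\<in>L. \<Sum>b\<in>B. p k a * q l b * M a b)"
    by (rule sum.swap)
  also have "\<dots> = (\<Sum>a\<in>A. \<Sum>k\<in>K. \<Sum>b\<in>B. \<Sum>l\<in>L. p k a * q l b * M a b)"
    by (intro sum.cong refl sum.swap)
  also have "\<dots> = (\<Sum>a\<in>A. \<Sum>b\<in>B. \<Sum>k\<in>K. \<Sum>l\<in>L. p k a * q l b * M a b)"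
    by (intro sum.cong refl sum.swap)
  also have "\<dots> = (\<Sum>a\<in>A. \<Sum>b\<in>B. (\<Sum>k\<in>K. p k a) * (\<Sum>l\<in>L. q l b) * M a b)"
    unfolding sum_product unfolding sum_distrib_right by (rule refl)
  finally show ?thesis .
qed

text \<open>Since \<open>T\<close> kills the off-diagonal units at \<open>diag(\<mu>)\<close>, its values at the companion matrix on the
  matrix units of the last column have as their last rows the moments
  \<open>\<Sum>\<^sub>i\<^sub>j \<mu>\<^sub>i\<^sup>a \<mu>\<^sub>j\<^sup>b m\<^sub>i\<^sub>j / (\<chi>'(\<mu>\<^sub>i) \<chi>'(\<mu>\<^sub>j))\<close>. The Bezoutian is the reproducing kernel of the pairing
  \<open>\<Sum>\<^sub>i f(\<mu>\<^sub>i) g(\<mu>\<^sub>i) / \<chi>'(\<mu>\<^sub>i)\<close> of polynomials, so the Hankel matrix recovers \<open>m\<^sub>i\<^sub>j\<close> from the moments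
  without denominators.\<close>

lemma diag_coeff_eigenvalue:
  fixes T :: "complex^'n^'n \<Rightarrow> complex^'n^'n \<Rightarrow> complex^'n^'n"
  assumes T: "covariant T" and \<mu>: "inj \<mu>"
    and off: "\<And>i j. i \<noteq> j \<Longrightarrow> T (diagmat \<mu>) (munit i j) = 0"
  shows "T (diagmat \<mu>) (munit j j) $ i $ i
    = (\<Sum>k\<in>UNIV. \<Sum>l\<in>UNIV. diag_coeff T k l (diagmat \<mu>) * \<mu> i ^ idx k * \<mu> j ^ idx l)"
proof -
  let ?L = "diagmat \<mu>" and ?W = "vandermonde \<mu>" and ?V = "horner_matrix \<mu>"
  let ?C = "companion ?L" and ?D = "diagmat (\<lambda>i. inverse (bezoutian_diag \<mu> i))"
  let ?m = "\<lambda>i j. T ?L (munit j j) $ i $ i"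
  have lin: "linear_family T" and equi: "equivariant T" using T by (auto simp: covariant_def)
  have nz: "bezoutian_diag \<mu> i \<noteq> 0" for i
    using bezoutian_diagmat[OF \<mu>, of i i] by (simp add: bezoutian_diag_def)
  have WVD: "?W ** (?V ** ?D) = mat 1"
    unfolding matrix_mul_assoc vandermonde_horner[OF \<mu>]
    using nz by (simp add: vec_eq_iff mat_def)
  then have VDW: "?V ** ?D ** ?W = mat 1"
    by (rule matrix_left_right_inverse[THEN iffD1])
  have moment: "T ?C (munit b last_ix) $ last_ix $ a
      = (\<Sum>i\<in>UNIV. \<Sum>j\<in>UNIV. \<mu> i ^ idx a * \<mu> j ^ idx b
          * (?m i j / (bezoutian_diag \<mu> i * bezoutian_diag \<mu> j)))" for a b
  proof -
    define Y where "Y = ?W ** munit b last_ix ** (?V ** ?D)"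
    have Y_nth: "Y $ i $ j = \<mu> i ^ idx b / bezoutian_diag \<mu> j" for i j
    proof -
      have "(?W ** munit b last_ix ** ?V) $ i $ j
          = (\<Sum>k\<in>UNIV. if k = last_ix then ?W $ i $ b * ?V $ k $ j else 0)"
        unfolding matrix_matrix_mult_def[of "?W ** munit b last_ix"]
        by (simp add: if_distrib if_distribR cong: if_cong)
      then show ?thesis
        by (simp add: Y_def matrix_mul_assoc horner_last_ix vandermonde_def divide_inverse)
    qed
    have TY: "T ?L Y = (\<Sum>j\<in>UNIV. mscale (Y $ j $ j) (T ?L (munit j j)))"
    proof -
      have "(\<Sum>l\<in>UNIV. mscale (Y $ k $ l) (T ?L (munit k l)))
          = (\<Sum>l\<in>UNIV. if l = k then mscale (Y $ k $ k) (T ?L (munit k k)) else 0)" for k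
        using off by (intro sum.cong) (auto simp: vec_eq_iff)
      then show ?thesis
        by (subst linear_family_expand[OF lin]) simp
    qed
    have TY_nth: "T ?L Y $ i $ j
        = (if i = j then (\<Sum>j\<in>UNIV. \<mu> j ^ idx b * ?m i j / bezoutian_diag \<mu> j) else 0)"
      for i j
    proof -
      have "T ?L (munit k k) $ i $ j = 0" if "i \<noteq> j" for k
        using that by (intro torus_weights[OF T]) auto
      then show ?thesis by (simp add: TY Y_nth)
    qed
    have "Y ** ?W = ?W ** munit b last_ix ** (?V ** ?D ** ?W)"
      by (simp add: Y_def matrix_mul_assoc)
    then have "Y ** ?W = ?W ** munit b last_ix"
      unfolding VDW by simp
    then have "T ?L Y ** ?W = ?W ** T ?C (munit b last_ix)"
      by (rule equivariantD[OF equi invertible_vandermonde[OF \<mu>] vandermonde_companion])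
    then have "?V ** ?D ** ?W ** T ?C (munit b last_ix) = ?V ** ?D ** (T ?L Y ** ?W)"
      by (simp add: matrix_mul_assoc)
    then have "T ?C (munit b last_ix) = ?V ** ?D ** (T ?L Y ** ?W)"
      unfolding VDW by simp
    moreover have "(?V ** ?D ** (T ?L Y ** ?W)) $ last_ix $ a
        = (\<Sum>i\<in>UNIV. inverse (bezoutian_diag \<mu> i) * (T ?L Y ** ?W) $ i $ a)"
      unfolding matrix_matrix_mult_def[of "?V ** ?D"] by (simp add: horner_last_ix)
    moreover have "(T ?L Y ** ?W) $ i $ a
        = (\<Sum>j\<in>UNIV. \<mu> j ^ idx b * ?m i j / bezoutian_diag \<mu> j) * \<mu> i ^ idx a" for i
      unfolding matrix_matrix_mult_def[of "T ?L Y"] TY_nth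
      by (simp add: vandermonde_def if_distrib if_distribR cong: if_cong)
    ultimately show ?thesis
      by (simp add: sum_distrib_left sum_distrib_right divide_inverse mult_ac)
  qed
  define u where "u i a = (\<Sum>k\<in>UNIV. hankel ?L k a * \<mu> i ^ idx k)" for i a
  have kernel: "(\<Sum>a\<in>UNIV. u i a * \<mu> i' ^ idx a) = (if i = i' then bezoutian_diag \<mu> i else 0)" for i i'
  proof -
    have "(\<Sum>a\<in>UNIV. u i a * \<mu> i' ^ idx a) = bezoutian ?L (\<mu> i) (\<mu> i')"
      unfolding bezoutian_def u_def sum_distrib_right by (rule sum.swap)
    then show ?thesis using bezoutian_diagmat[OF \<mu>, of i i'] by (simp add: bezoutian_diag_def)
  qed
  let ?f = "\<lambda>i' j'. ?m i' j' / (bezoutian_diag \<mu> i' * bezoutian_diag \<mu> j')"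
  have "(\<Sum>k\<in>UNIV. \<Sum>l\<in>UNIV. diag_coeff T k l ?L * \<mu> i ^ idx k * \<mu> j ^ idx l)
      = (\<Sum>k\<in>UNIV. \<Sum>l\<in>UNIV. \<Sum>a\<in>UNIV. \<Sum>b\<in>UNIV. (hankel ?L k a * \<mu> i ^ idx k) *
          (hankel ?L l b * \<mu> j ^ idx l) * T ?C (munit b last_ix) $ last_ix $ a)"
    unfolding diag_coeff_def sum_distrib_right by (intro sum.cong refl) (simp add: mult_ac)
  also have "\<dots> = (\<Sum>a\<in>UNIV. \<Sum>b\<in>UNIV. u i a * u j b * T ?C (munit b last_ix) $ last_ix $ a)"
    unfolding u_def by (rule sum_bilinear)
  also have "\<dots> = (\<Sum>a\<in>UNIV. \<Sum>b\<in>UNIV. \<Sum>i'\<in>UNIV. \<Sum>j'\<in>UNIV.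
      (u i a * \<mu> i' ^ idx a) * (u j b * \<mu> j' ^ idx b) * ?f i' j')"
    unfolding moment sum_distrib_left by (intro sum.cong refl) (simp only: mult_ac)
  also have "\<dots> = (\<Sum>i'\<in>UNIV. \<Sum>j'\<in>UNIV.
      (\<Sum>a\<in>UNIV. u i a * \<mu> i' ^ idx a) * (\<Sum>b\<in>UNIV. u j b * \<mu> j' ^ idx b) * ?f i' j')"
    by (rule sum_bilinear)
  also have "\<dots> = (\<Sum>i'\<in>UNIV. \<Sum>j'\<in>UNIV. if j = j' then if i = i' then ?m i j else 0 else 0)"
    unfolding kernel using nz by (intro sum.cong refl) simp
  also have "\<dots> = ?m i j" by simp
  finally show ?thesis ..
qed

text \<open>Subtracting the words \<open>A\<^sup>k Y A\<^sup>l\<close> with the off-diagonal coefficients leaves a family that kills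
  all \<open>E\<^sub>i\<^sub>j\<close> with \<open>i \<noteq> j\<close> at diagonal matrices, which is what \<open>diag_coeff_eigenvalue\<close> needs.\<close>

theorem covariant_decomposition:
  fixes T :: "complex^'n^'n \<Rightarrow> complex^'n^'n \<Rightarrow> complex^'n^'n"
  assumes T: "covariant T"
  obtains P Q :: "'n \<Rightarrow> 'n \<Rightarrow> complex^'n^'n \<Rightarrow> complex"
  where "\<And>k l. invariant_fun (P k l)" and "\<And>k l. invariant_fun (Q k l)"
    and "\<And>A Y. T A Y = (\<Sum>k\<in>UNIV. \<Sum>l\<in>UNIV. mscale (P k l A) (sandwich (idx k) (idx l) A Y))
      + (\<Sum>k\<in>UNIV. \<Sum>l\<in>UNIV. mscale (Q k l A) (dyad (idx k) (idx l) A Y))"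
proof -
  define P where "P = offdiag_coeff T"
  define TP where
    "TP A Y = (\<Sum>k\<in>UNIV. \<Sum>l\<in>UNIV. mscale (P k l A) (sandwich (idx k) (idx l) A Y))" for A Y
  define T1 where "T1 A Y = T A Y - TP A Y" for A Y
  define Q where "Q = diag_coeff T1"
  define TQ where
    "TQ A Y = (\<Sum>k\<in>UNIV. \<Sum>l\<in>UNIV. mscale (Q k l A) (dyad (idx k) (idx l) A Y))" for A Y
  have P: "invariant_fun (P k l)" for k l
    unfolding P_def by (rule invariant_fun_offdiag_coeff[OF T])
  have "covariant TP"
    unfolding TP_def by (intro covariant_sum covariant_scale covariant_sandwich P)
  then have T1: "covariant T1"
    unfolding T1_def by (rule covariant_diff[OF T])
  have Q: "invariant_fun (Q k l)" for k l
    unfolding Q_def by (rule invariant_fun_diag_coeff[OF T1])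
  have TQ: "covariant TQ"
    unfolding TQ_def by (intro covariant_sum covariant_scale covariant_dyad Q)
  have "T1 A Y = TQ A Y" for A Y
  proof (rule covariant_eq_if_eq_on_diagonal[OF T1 TQ])
    fix \<mu> :: "'n \<Rightarrow> complex" and i j a b
    assume \<mu>: "inj \<mu>"
    let ?L = "diagmat \<mu>"
    have off: "T1 ?L (munit i j) = 0" if "i \<noteq> j" for i j
    proof -
      have "T1 ?L (munit i j) $ i $ j = 0"
        using offdiag_coeff_eigenvalue[OF T \<mu> that]
        by (simp add: T1_def TP_def P_def sandwich_def mpow_diagmat mult_ac)
      then have "T1 ?L (munit i j) $ a $ b = 0" for a b
        using torus_weights[OF T1, of a i b j \<mu>] that by (cases "a = i \<and> b = j") auto
      then show ?thesis by (simp add: vec_eq_iff)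
    qed
    have trace_unit: "trace (mpow ?L k ** munit i j) = (if i = j then \<mu> i ^ k else 0)" for i j k
      by (cases "i = j") (auto simp: mpow_diagmat trace_diagmat_mult if_distrib
          cong: if_cong intro!: sum.neutral)
    show "T1 ?L (munit i j) $ a $ b = TQ ?L (munit i j) $ a $ b"
    proof (cases "i = j")
      case False
      then show ?thesis
        unfolding TQ_def dyad_def trace_unit using off[OF False] by simp
    next
      case True
      have TQ: "TQ ?L (munit j j) $ a $ b
          = (if a = b then \<Sum>k\<in>UNIV. \<Sum>l\<in>UNIV. Q k l ?L * \<mu> a ^ idx k * \<mu> j ^ idx l else 0)"
        unfolding TQ_def dyad_def trace_unit by (simp add: mpow_diagmat mult_ac)
      show ?thesis
      proof (cases "a = b")
        case a: True
        show ?thesis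
          unfolding True TQ using diag_coeff_eigenvalue[OF T1 \<mu> off, of j a] a
          by (simp add: Q_def)
      next
        case False
        then have "T1 ?L (munit j j) $ a $ b = 0"
          by (intro torus_weights[OF T1]) auto
        then show ?thesis unfolding True TQ using False by simp
      qed
    qed
  qed
  then have "T A Y = TP A Y + TQ A Y" for A Y
    by (simp add: T1_def algebra_simps)
  then show ?thesis
    by (intro that[of P Q] P Q) (simp add: TP_def TQ_def)
qed

section \<open>Coordinates with respect to the trace form\<close>

lemma matrix_inv_inverse:
  fixes A :: "complex^'n^'n"
  assumes "invertible A"
  shows "A ** matrix_inv A = mat 1" and "matrix_inv A ** A = mat 1"
  using someI_ex[OF assms[unfolded invertible_def]] unfolding matrix_inv_def by auto

lemma matrix_inv_unique:
  fixes A B :: "complex^'n^'n"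
  assumes "A ** B = mat 1" "B ** A = mat 1"
  shows "matrix_inv A = B"
proof -
  have "invertible A" using assms unfolding invertible_def by blast
  then have "matrix_inv A = matrix_inv A ** (A ** B)" "matrix_inv A ** A = mat 1"
    by (simp_all add: assms(1) matrix_inv_inverse)
  then show ?thesis by (simp add: matrix_mul_assoc)
qed

definition traceless_part :: "complex^'n^'n \<Rightarrow> complex^'n^'n" where
  "traceless_part A = A - mscale (trace A / of_nat CARD('n)) (mat 1)"

text \<open>The point of \<open>g\<^sup>*\<close> that corresponds to \<open>A\<close> under the trace form, and the coordinates of \<open>Y\<close>.
  Both ignore multiples of the identity, so they are defined on all matrices.\<close>

definition trace_point :: "('a \<Rightarrow> complex^'n^'n) \<Rightarrow> complex^'n^'n \<Rightarrow> 'a \<Rightarrow> complex" where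
  "trace_point x A \<alpha> = trace (x \<alpha> ** A)"

definition trace_coord :: "('a::finite \<Rightarrow> complex^'n^'n) \<Rightarrow> 'a \<Rightarrow> complex^'n^'n \<Rightarrow> complex" where
  "trace_coord x \<alpha> Y = (\<Sum>\<gamma>\<in>UNIV. inv_trace_form x $ \<alpha> $ \<gamma> * trace (x \<gamma> ** Y))"

definition combination :: "('a::finite \<Rightarrow> complex^'n^'n) \<Rightarrow> ('a \<Rightarrow> complex) \<Rightarrow> complex^'n^'n" where
  "combination x c = (\<Sum>\<alpha>\<in>UNIV. mscale (c \<alpha>) (x \<alpha>))"

lemma combination_nth: "combination x c $ i $ j = (\<Sum>\<alpha>\<in>UNIV. c \<alpha> * x \<alpha> $ i $ j)"
  by (simp add: combination_def)

lemma combination_add: "combination x (\<lambda>\<alpha>. c \<alpha> + d \<alpha>) = combination x c + combination x d"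
  by (simp only: combination_def mvs.scale_left_distrib sum.distrib)

lemma combination_scale: "combination x (\<lambda>\<alpha>. c * d \<alpha>) = mscale c (combination x d)"
  by (simp add: vec_eq_iff combination_nth sum_distrib_left mult.assoc)

lemma trace_sum: "trace (\<Sum>i\<in>I. f i) = (\<Sum>i\<in>I. trace (f i))"
  for f :: "'i \<Rightarrow> complex^'n^'n"
  by (induction I rule: infinite_finite_induct) (simp_all add: trace_add trace_0[simplified])

lemma trace_mult_combination:
  "trace (A ** combination x c) = (\<Sum>\<alpha>\<in>UNIV. c \<alpha> * trace (A ** x \<alpha>))"
  by (simp add: combination_def matrix_sum_right trace_sum mscale_mult_right trace_mscale)

lemma trace_coord_add: "trace_coord x \<alpha> (Y + Z) = trace_coord x \<alpha> Y + trace_coord x \<alpha> Z"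
  by (simp add: trace_coord_def matrix_add_ldistrib trace_add algebra_simps sum.distrib)

lemma trace_coord_mscale: "trace_coord x \<alpha> (mscale c Y) = c * trace_coord x \<alpha> Y"
  by (simp add: trace_coord_def mscale_mult_right trace_mscale sum_distrib_left mult_ac)

lemma trace_coord_0: "trace_coord x \<alpha> 0 = 0"
  using trace_coord_mscale[of x \<alpha> 0 0] by simp

lemma trace_coord_sum: "trace_coord x \<alpha> (\<Sum>i\<in>I. f i) = (\<Sum>i\<in>I. trace_coord x \<alpha> (f i))"
  by (induction I rule: infinite_finite_induct) (simp_all add: trace_coord_0 trace_coord_add)

lemma traceless_part_in_sl: "traceless_part A \<in> sl"
  by (simp add: traceless_part_def sl_def trace_mscale trace_sub trace_I)

lemma traceless_part_sl: "A \<in> sl \<Longrightarrow> traceless_part A = A"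
  by (simp add: traceless_part_def sl_def)

lemma traceless_part_add: "traceless_part (A + B) = traceless_part A + traceless_part B"
  by (simp add: traceless_part_def trace_add add_divide_distrib mvs.scale_left_distrib)

lemma traceless_part_mscale: "traceless_part (mscale c A) = mscale c (traceless_part A)"
  by (simp add: traceless_part_def trace_mscale vec_eq_iff algebra_simps)

lemma traceless_part_0: "traceless_part 0 = 0"
  using traceless_part_mscale[of 0 0] by simp

lemma traceless_part_sum: "traceless_part (\<Sum>i\<in>I. f i) = (\<Sum>i\<in>I. traceless_part (f i))"
proof (induction I rule: infinite_finite_induct)
  case (insert i I)
  then show ?case by (simp add: traceless_part_add)
qed (simp_all add: traceless_part_def trace_def vec_eq_iff)

lemma mscale_mat_1_mult: "mscale c (mat 1) ** A = mscale c A" "A ** mscale c (mat 1) = mscale c A"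
  by (simp_all add: mscale_mult_left mscale_mult_right)

lemma traceless_part_intertwine:
  fixes g :: "complex^'n^'n"
  assumes "invertible g" "A' ** g = g ** A"
  shows "traceless_part A' ** g = g ** traceless_part A"
  using assms trace_intertwine[OF assms]
  by (simp add: traceless_part_def matrix_diff_left_distrib matrix_diff_right_distrib
      mscale_mat_1_mult)

text \<open>The trace form is nondegenerate on traceless matrices: it is enough to pair with the
  off-diagonal matrix units and the differences of two diagonal ones.\<close>

lemma trace_form_nondegenerate:
  fixes y :: "complex^'n^'n"
  assumes "y \<in> sl" and orth: "\<And>z. z \<in> sl \<Longrightarrow> trace (z ** y) = 0"
  shows "y = 0"
proof -
  have unit: "trace (munit i j ** y) = y $ j $ i" for i j
    by (simp add: trace_def)
  have tr: "trace (munit i j :: complex^'n^'n) = (if i = j then 1 else 0)" for i j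
    by (cases "i = j") (auto simp: trace_def intro!: sum.neutral)
  have off: "y $ j $ i = 0" if "i \<noteq> j" for i j
    using orth[of "munit i j"] that unit[of i j] tr[of i j] by (simp add: sl_def)
  have diag: "y $ i $ i = y $ j $ j" for i j
  proof -
    have "trace ((munit i i - munit j j) ** y) = 0"
      by (rule orth) (simp add: sl_def trace_sub tr)
    then show ?thesis by (simp add: matrix_diff_left_distrib trace_sub unit)
  qed
  have "y $ i $ i = 0" for i
  proof -
    have "trace y = (\<Sum>j\<in>(UNIV :: 'n set). y $ i $ i)"
      unfolding trace_def by (intro sum.cong refl diag)
    then show ?thesis using \<open>y \<in> sl\<close> by (simp add: sl_def)
  qed
  then have "y $ i $ j = 0" for i j
    using off by (cases "i = j") auto
  then show ?thesis by (simp add: vec_eq_iff)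
qed

locale sl_basis =
  fixes x :: "'a::finite \<Rightarrow> complex^'n^'n"
  assumes basis: "is_basis x sl"
begin

lemma coord_combination: "coord x \<beta> (combination x c) = c \<beta>"
proof -
  have ind: "mvs.independent (range x)" and inj: "inj x"
    using basis by (auto simp: is_basis_def)
  have span: "x \<alpha> \<in> mvs.span (range x)" for \<alpha>
    by (simp add: mvs.span_base)
  have "coord x \<beta> (combination x c)
      = (\<Sum>\<alpha>\<in>UNIV. c \<alpha> * mvs.representation (range x) (x \<alpha>) (x \<beta>))"
    unfolding coord_def combination_def
    by (simp add: mvs.representation_sum[OF ind] mvs.representation_scale[OF ind]
        mvs.span_scale span)
  also have "\<dots> = (\<Sum>\<alpha>\<in>UNIV. if \<alpha> = \<beta> then c \<alpha> else 0)"
    using inj by (intro sum.cong) (auto simp: mvs.representation_basis[OF ind] inj_eq)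
  finally show ?thesis by simp
qed

lemma combination_coord:
  assumes "y \<in> sl"
  shows "combination x (\<lambda>\<alpha>. coord x \<alpha> y) = y"
proof -
  have "(\<Sum>b\<in>range x. mscale (mvs.representation (range x) y b) b) = y"
    using basis assms by (intro mvs.sum_representation_eq) (auto simp: is_basis_def)
  then show ?thesis
    using basis by (simp add: sum.reindex is_basis_def combination_def coord_def)
qed

lemma basis_in_sl: "x \<alpha> \<in> sl"
  using basis mvs.span_base[of "x \<alpha>" "range x"] by (auto simp: is_basis_def)

lemma combination_in_sl: "combination x c \<in> sl"
  using basis_in_sl
  by (simp add: combination_def sl_def trace_sum trace_mscale)

lemma invertible_trace_form: "invertible (trace_form x)"
  unfolding invertible_iff_ker
proof (intro allI impI)
  fix c :: "complex^'a"
  assume c: "trace_form x *v c = 0"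
  let ?y = "combination x (\<lambda>\<alpha>. c $ \<alpha>)"
  have "trace (x \<beta> ** ?y) = (trace_form x *v c) $ \<beta>" for \<beta>
    by (simp add: trace_mult_combination trace_form_def matrix_vector_mult_def mult.commute)
  then have "trace (?y ** x \<beta>) = 0" for \<beta>
    using c trace_mul_sym[of ?y "x \<beta>"] by simp
  then have "trace (?y ** combination x d) = 0" for d
    by (simp add: trace_mult_combination)
  then have "trace (z ** ?y) = 0" if "z \<in> sl" for z
    using combination_coord[OF that] trace_mul_sym[of z ?y] by metis
  then have "?y = 0"
    by (rule trace_form_nondegenerate[OF combination_in_sl])
  moreover have "combination x (\<lambda>\<alpha>. 0) = 0"
    by (simp add: combination_def)
  ultimately have "c $ \<alpha> = 0" for \<alpha>
    using coord_combination[of \<alpha> "\<lambda>\<alpha>. c $ \<alpha>"] coord_combination[of \<alpha> "\<lambda>\<alpha>. 0"] by simp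
  then show "c = 0" by (simp add: vec_eq_iff)
qed

lemma inv_trace_form_inverse:
  "trace_form x ** inv_trace_form x = mat 1" "inv_trace_form x ** trace_form x = mat 1"
  unfolding inv_trace_form_def by (rule matrix_inv_inverse[OF invertible_trace_form])+

lemma trace_coord_combination: "trace_coord x \<alpha> (combination x c) = c \<alpha>"
proof -
  have "trace_coord x \<alpha> (combination x c)
      = (\<Sum>\<gamma>\<in>UNIV. \<Sum>\<beta>\<in>UNIV. inv_trace_form x $ \<alpha> $ \<gamma> * trace_form x $ \<gamma> $ \<beta> * c \<beta>)"
    by (simp add: trace_coord_def trace_mult_combination trace_form_def sum_distrib_left mult_ac)
  also have "\<dots> = (\<Sum>\<beta>\<in>UNIV. (inv_trace_form x ** trace_form x) $ \<alpha> $ \<beta> * c \<beta>)"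
    by (subst sum.swap) (simp add: matrix_matrix_mult_def sum_distrib_right)
  also have "\<dots> = c \<alpha>"
    unfolding inv_trace_form_inverse
    by (simp add: mat_def if_distrib if_distribR cong: if_cong)
  finally show ?thesis .
qed

lemma trace_coord_eq_coord:
  assumes "y \<in> sl"
  shows "trace_coord x \<alpha> y = coord x \<alpha> y"
  using trace_coord_combination[of \<alpha> "\<lambda>\<alpha>. coord x \<alpha> y"] combination_coord[OF assms] by simp

lemma trace_mult_traceless_part: "trace (x \<alpha> ** traceless_part A) = trace (x \<alpha> ** A)"
  using basis_in_sl[of \<alpha>]
  by (simp add: traceless_part_def matrix_diff_right_distrib mscale_mat_1_mult trace_mscale
      trace_sub sl_def)

lemma combination_trace_coord: "combination x (\<lambda>\<alpha>. trace_coord x \<alpha> A) = traceless_part A"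
proof -
  have "trace_coord x \<alpha> A = coord x \<alpha> (traceless_part A)" for \<alpha>
    unfolding trace_coord_eq_coord[OF traceless_part_in_sl, symmetric]
    by (simp add: trace_coord_def trace_mult_traceless_part)
  then show ?thesis
    by (simp add: combination_coord[OF traceless_part_in_sl])
qed

lemma sl_eqI:
  assumes "y \<in> sl" "z \<in> sl" "\<And>\<alpha>. trace_coord x \<alpha> y = trace_coord x \<alpha> z"
  shows "y = z"
proof -
  have "traceless_part y = traceless_part z"
    unfolding combination_trace_coord[symmetric] assms(3) ..
  then show ?thesis using assms(1,2) by (simp only: traceless_part_sl)
qed

text \<open>The inverse of \<^const>\<open>trace_point\<close> on traceless matrices. Its entries are the values of the entries
  of \<^const>\<open>F_mat\<close>, by which a polynomial function of a matrix becomes a polynomial on \<open>g\<^sup>*\<close>.\<close>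

definition point_matrix :: "('a \<Rightarrow> complex) \<Rightarrow> complex^'n^'n" where
  "point_matrix \<xi> = combination x (\<lambda>\<alpha>. \<Sum>\<beta>\<in>UNIV. inv_trace_form x $ \<alpha> $ \<beta> * \<xi> \<beta>)"

lemma point_matrix_in_sl: "point_matrix \<xi> \<in> sl"
  by (simp add: point_matrix_def combination_in_sl)

lemma point_matrix_trace_point: "point_matrix (trace_point x A) = traceless_part A"
  unfolding point_matrix_def trace_point_def
  using combination_trace_coord[of A] by (simp add: trace_coord_def)

lemma trace_point_point_matrix: "trace_point x (point_matrix \<xi>) = \<xi>"
proof
  fix \<gamma>
  have "trace_point x (point_matrix \<xi>) \<gamma>
      = (\<Sum>\<alpha>\<in>UNIV. \<Sum>\<beta>\<in>UNIV. trace_form x $ \<gamma> $ \<alpha> * inv_trace_form x $ \<alpha> $ \<beta> * \<xi> \<beta>)"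
    by (simp add: trace_point_def point_matrix_def trace_mult_combination trace_form_def
        sum_distrib_left sum_distrib_right mult_ac)
  also have "\<dots> = (\<Sum>\<beta>\<in>UNIV. (trace_form x ** inv_trace_form x) $ \<gamma> $ \<beta> * \<xi> \<beta>)"
    by (subst sum.swap) (simp add: matrix_matrix_mult_def sum_distrib_right)
  also have "\<dots> = \<xi> \<gamma>"
    unfolding inv_trace_form_inverse
    by (simp add: mat_def if_distrib if_distribR cong: if_cong)
  finally show "trace_point x (point_matrix \<xi>) \<gamma> = \<xi> \<gamma>" .
qed

lemma peval_F_mat: "peval (F_mat x $ i $ j) \<xi> = point_matrix \<xi> $ i $ j"
  by (simp add: F_mat_def point_matrix_def combination_nth peval_sum sum_distrib_left
      sum_distrib_right mult_ac)

lemma matpoly_to_polynomial: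
  assumes "matpoly f"
  shows "\<exists>P. \<forall>\<xi>. peval P \<xi> = f (point_matrix \<xi>)"
  using assms
proof (induction rule: matpoly.induct)
  case (const c)
  show ?case by (rule exI[of _ "pconst c"]) simp
next
  case (entry i j)
  show ?case by (rule exI[of _ "F_mat x $ i $ j"]) (simp add: peval_F_mat)
next
  case (add f g)
  then obtain P Q where "\<forall>\<xi>. peval P \<xi> = f (point_matrix \<xi>)"
    "\<forall>\<xi>. peval Q \<xi> = g (point_matrix \<xi>)" by blast
  then show ?case by (intro exI[of _ "P + Q"]) simp
next
  case (mult f g)
  then obtain P Q where "\<forall>\<xi>. peval P \<xi> = f (point_matrix \<xi>)"
    "\<forall>\<xi>. peval Q \<xi> = g (point_matrix \<xi>)" by blast
  then show ?case by (intro exI[of _ "P * Q"]) simp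
qed

section \<open>The family algebra as an algebra of equivariant families\<close>

text \<open>Evaluation at the point of \<open>g\<^sup>*\<close> given by \<open>A\<close> turns an element of \<open>End(g) \<otimes> \<complex>[g\<^sup>*]\<close> into an
  operator on \<open>g\<close>, extended to all matrices.\<close>

definition operator :: "'a cpoly^'a^'a \<Rightarrow> complex^'n^'n \<Rightarrow> complex^'n^'n \<Rightarrow> complex^'n^'n" where
  "operator U A Y =
    combination x (\<lambda>\<alpha>. \<Sum>\<beta>\<in>UNIV. peval (U $ \<alpha> $ \<beta>) (trace_point x A) * trace_coord x \<beta> Y)"

lemma operator_in_sl: "operator U A Y \<in> sl"
  by (simp add: operator_def combination_in_sl)

lemma trace_coord_operator:
  "trace_coord x \<alpha> (operator U A Y)
    = (\<Sum>\<beta>\<in>UNIV. peval (U $ \<alpha> $ \<beta>) (trace_point x A) * trace_coord x \<beta> Y)"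
  by (simp add: operator_def trace_coord_combination)

lemma operator_inject:
  assumes "\<And>A Y. A \<in> sl \<Longrightarrow> Y \<in> sl \<Longrightarrow> operator U A Y = operator V A Y"
  shows "U = V"
proof -
  have unit: "trace_coord x \<beta> (x \<gamma>) = (if \<beta> = \<gamma> then 1 else 0)" for \<beta> \<gamma>
  proof -
    have "combination x (\<lambda>\<beta>. if \<beta> = \<gamma> then 1 else 0) = x \<gamma>"
      by (simp add: vec_eq_iff combination_nth if_distrib if_distribR cong: if_cong)
    then show ?thesis
      using trace_coord_combination[of \<beta> "\<lambda>\<beta>. if \<beta> = \<gamma> then 1 else 0"] by simp
  qed
  have "peval (U $ \<alpha> $ \<beta>) \<xi> = peval (V $ \<alpha> $ \<beta>) \<xi>" for \<alpha> \<beta> \<xi>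
  proof -
    have "trace_coord x \<alpha> (operator U (point_matrix \<xi>) (x \<beta>))
        = trace_coord x \<alpha> (operator V (point_matrix \<xi>) (x \<beta>))"
      using assms[OF point_matrix_in_sl basis_in_sl] by simp
    then show ?thesis
      unfolding trace_coord_operator unit
      by (simp add: trace_point_point_matrix if_distrib cong: if_cong)
  qed
  then show ?thesis
    by (simp add: vec_eq_iff peval_eq_imp_eq)
qed

lemma operator_add: "operator (U + V) A Y = operator U A Y + operator V A Y"
proof -
  have "(\<Sum>\<beta>\<in>UNIV. peval ((U + V) $ \<alpha> $ \<beta>) \<xi> * y \<beta>)
      = (\<Sum>\<beta>\<in>UNIV. peval (U $ \<alpha> $ \<beta>) \<xi> * y \<beta>) + (\<Sum>\<beta>\<in>UNIV. peval (V $ \<alpha> $ \<beta>) \<xi> * y \<beta>)"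
    for \<alpha> \<xi> y
    by (simp add: distrib_right sum.distrib)
  then show ?thesis by (simp only: operator_def combination_add)
qed

lemma sum_mult_assoc:
  fixes y :: "_ \<Rightarrow> 'r::semiring_0"
  shows "(\<Sum>b\<in>B. (\<Sum>c\<in>C. u c * v c b) * y b) = (\<Sum>c\<in>C. u c * (\<Sum>b\<in>B. v c b * y b))"
proof -
  have "(\<Sum>b\<in>B. (\<Sum>c\<in>C. u c * v c b) * y b) = (\<Sum>b\<in>B. \<Sum>c\<in>C. u c * v c b * y b)"
    by (simp add: sum_distrib_right)
  also have "\<dots> = (\<Sum>c\<in>C. \<Sum>b\<in>B. u c * v c b * y b)"
    by (rule sum.swap)
  also have "\<dots> = (\<Sum>c\<in>C. u c * (\<Sum>b\<in>B. v c b * y b))"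
    by (simp add: sum_distrib_left mult.assoc)
  finally show ?thesis .
qed

lemma operator_mult: "operator (U ** V) A Y = operator U A (operator V A Y)"
proof (rule sl_eqI)
  fix \<alpha>
  have "peval ((U ** V) $ \<alpha> $ \<beta>) \<xi> = (\<Sum>\<gamma>\<in>UNIV. peval (U $ \<alpha> $ \<gamma>) \<xi> * peval (V $ \<gamma> $ \<beta>) \<xi>)" for \<beta> \<xi>
    by (simp add: matrix_matrix_mult_def peval_sum)
  then show "trace_coord x \<alpha> (operator (U ** V) A Y)
      = trace_coord x \<alpha> (operator U A (operator V A Y))"
    by (simp only: trace_coord_operator sum_mult_assoc)
qed (rule operator_in_sl)+

lemma operator_mat: "operator (mat P) A Y = mscale (peval P (trace_point x A)) (traceless_part Y)"
proof -
  have "(\<Sum>\<beta>\<in>UNIV. peval (mat P $ \<alpha> $ \<beta>) (trace_point x A) * trace_coord x \<beta> Y)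
      = peval P (trace_point x A) * trace_coord x \<alpha> Y" for \<alpha>
  proof -
    have "peval (mat P $ \<alpha> $ \<beta>) \<xi> = (if \<alpha> = \<beta> then peval P \<xi> else 0)" for \<beta> \<xi>
      by (simp add: mat_def)
    then have "(\<Sum>\<beta>\<in>UNIV. peval (mat P $ \<alpha> $ \<beta>) (trace_point x A) * trace_coord x \<beta> Y)
        = (\<Sum>\<beta>\<in>UNIV. if \<alpha> = \<beta> then peval P (trace_point x A) * trace_coord x \<beta> Y else 0)"
      by (intro sum.cong refl) simp
    then show ?thesis by simp
  qed
  then have "operator (mat P) A Y
      = combination x (\<lambda>\<alpha>. peval P (trace_point x A) * trace_coord x \<alpha> Y)"
    by (simp only: operator_def)
  then show ?thesis by (simp only: combination_scale combination_trace_coord)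
qed

lemma operator_traceless_part: "operator U (traceless_part A) (traceless_part Y) = operator U A Y"
  by (simp add: operator_def trace_coord_def trace_point_def[abs_def] trace_mult_traceless_part)

lemma covariant_operator:
  assumes "equivariant (operator U)"
  shows "covariant (operator U)"
proof -
  have "linear_family (operator U)"
    unfolding linear_family_def
    by (auto simp: vec_eq_iff operator_def combination_nth trace_coord_add trace_coord_mscale
        algebra_simps sum.distrib sum_distrib_left)
  moreover have "matpoly (\<lambda>A. operator U A Y $ i $ j)" for Y i j
    unfolding operator_def combination_nth trace_point_def[abs_def]
    by (intro matpoly_sum matpoly.mult matpoly_peval matpoly.const matpoly_trace matpoly_mat_mult
        matpoly.entry)
  ultimately show ?thesis using assms by (simp add: covariant_def)
qed

section \<open>The action of the adjoint group\<close>

lemma conjugate_in_sl: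
  fixes g h :: "complex^'n^'n"
  assumes "h ** g = mat 1" "A \<in> sl"
  shows "g ** A ** h \<in> sl"
  using assms trace_mul_sym[of "g ** A" h] by (simp add: sl_def matrix_mul_assoc)

lemma trace_point_conjugate:
  "trace_point x (h ** A ** g) \<beta> = trace (g ** x \<beta> ** h ** A)"
  using trace_mul_sym[of "x \<beta> ** h ** A" g] by (simp add: trace_point_def matrix_mul_assoc)

lemma peval_poly_act:
  assumes inv: "g ** h = mat 1" "h ** g = mat 1"
  shows "peval (poly_act x (Ad g) P) (trace_point x A) = peval P (trace_point x (h ** A ** g))"
proof -
  have g: "matrix_inv g = h" using inv by (rule matrix_inv_unique)
  have "(\<Sum>\<alpha>\<in>UNIV. basis_matrix x (Ad g) $ \<alpha> $ \<beta> * trace_point x A \<alpha>)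
      = trace_point x (h ** A ** g) \<beta>" for \<beta>
  proof -
    let ?y = "g ** x \<beta> ** h"
    have "?y \<in> sl" using inv(2) basis_in_sl by (rule conjugate_in_sl)
    have "(\<Sum>\<alpha>\<in>UNIV. basis_matrix x (Ad g) $ \<alpha> $ \<beta> * trace_point x A \<alpha>)
        = trace (A ** combination x (\<lambda>\<alpha>. coord x \<alpha> ?y))"
      by (simp add: trace_mult_combination basis_matrix_def trace_point_def Ad_def g
          trace_mul_sym[of A])
    also have "\<dots> = trace (?y ** A)"
      unfolding combination_coord[OF \<open>?y \<in> sl\<close>] by (rule trace_mul_sym)
    finally show ?thesis by (simp add: trace_point_conjugate)
  qed
  then show ?thesis
    by (simp add: poly_act_def peval_psubst peval_sum)
qed

lemma basis_matrix_Ad_coord: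
  assumes inv: "g ** h = mat 1" "h ** g = mat 1" and "Y \<in> sl"
  shows "(\<Sum>\<beta>\<in>UNIV. basis_matrix x (Ad g) $ \<alpha> $ \<beta> * trace_coord x \<beta> Y)
    = trace_coord x \<alpha> (g ** Y ** h)"
proof -
  have g: "matrix_inv g = h" using inv by (rule matrix_inv_unique)
  have "g ** Y ** h = g ** combination x (\<lambda>\<beta>. trace_coord x \<beta> Y) ** h"
    using \<open>Y \<in> sl\<close> by (simp add: combination_trace_coord traceless_part_sl)
  also have "\<dots> = (\<Sum>\<beta>\<in>UNIV. mscale (trace_coord x \<beta> Y) (g ** x \<beta> ** h))"
    by (simp add: combination_def matrix_sum_left matrix_sum_right mscale_mult_left
        mscale_mult_right)
  finally show ?thesis
    by (simp add: trace_coord_sum trace_coord_mscale basis_matrix_def Ad_def g mult.commute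
        trace_coord_eq_coord[OF conjugate_in_sl[OF inv(2) basis_in_sl]])
qed

lemma operator_basis_matrix:
  assumes inv: "g ** h = mat 1" "h ** g = mat 1" and "Y \<in> sl"
  shows "operator (map_matrix pconst (basis_matrix x (Ad g))) A Y = g ** Y ** h"
proof (rule sl_eqI[OF operator_in_sl conjugate_in_sl[OF inv(2) \<open>Y \<in> sl\<close>]])
  show "trace_coord x \<alpha> (operator (map_matrix pconst (basis_matrix x (Ad g))) A Y)
      = trace_coord x \<alpha> (g ** Y ** h)" for \<alpha>
    by (simp add: trace_coord_operator basis_matrix_Ad_coord[OF assms])
qed

lemma matrix_inv_basis_matrix:
  assumes inv: "g ** h = mat 1" "h ** g = mat 1"
  shows "matrix_inv (basis_matrix x (Ad g)) = basis_matrix x (Ad h)"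
proof -
  have "basis_matrix x (Ad g) ** basis_matrix x (Ad h) = mat 1"
    if inv: "g ** h = mat 1" "h ** g = mat 1" for g h
  proof -
    have h: "matrix_inv h = g" using inv(2,1) by (rule matrix_inv_unique)
    have "(basis_matrix x (Ad g) ** basis_matrix x (Ad h)) $ \<alpha> $ \<beta> = mat 1 $ \<alpha> $ \<beta>" for \<alpha> \<beta>
    proof -
      let ?y = "h ** x \<beta> ** g"
      have y: "?y \<in> sl" using inv(1) basis_in_sl by (rule conjugate_in_sl)
      have unit: "combination x (\<lambda>\<gamma>. if \<gamma> = \<beta> then 1 else 0) = x \<beta>"
        by (simp add: vec_eq_iff combination_nth if_distrib if_distribR cong: if_cong)
      have "g ** ?y ** h = (g ** h) ** x \<beta> ** (g ** h)"
        by (simp only: matrix_mul_assoc)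
      then have "(basis_matrix x (Ad g) ** basis_matrix x (Ad h)) $ \<alpha> $ \<beta>
          = trace_coord x \<alpha> (x \<beta>)"
        using basis_matrix_Ad_coord[OF inv y, of \<alpha>] inv(1)
        by (simp add: matrix_matrix_mult_def[of "basis_matrix x (Ad g)"] trace_coord_eq_coord[OF y]
            basis_matrix_def[of x "Ad h"] Ad_def[of h] h)
      also have "\<dots> = (if \<alpha> = \<beta> then 1 else 0)"
        using trace_coord_combination[of \<alpha> "\<lambda>\<gamma>. if \<gamma> = \<beta> then 1 else 0"] by (simp add: unit)
      finally show ?thesis by (simp add: mat_def)
    qed
    then show ?thesis by (simp add: vec_eq_iff)
  qed
  from this[OF inv] this[OF inv(2,1)] show ?thesis
    by (rule matrix_inv_unique)
qed

lemma operator_end_act: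
  assumes inv: "g ** h = mat 1" "h ** g = mat 1" and "Y \<in> sl"
  shows "operator (end_act x (Ad g) U) A Y = g ** operator U (h ** A ** g) (h ** Y ** g) ** h"
proof -
  have "operator (map_matrix (poly_act x (Ad g)) U) A Z = operator U (h ** A ** g) Z" for Z
    by (simp add: operator_def peval_poly_act[OF inv])
  then show ?thesis
    unfolding end_act_def operator_mult matrix_inv_basis_matrix[OF inv]
    using operator_basis_matrix[OF inv operator_in_sl] operator_basis_matrix[OF inv(2,1) \<open>Y \<in> sl\<close>]
    by simp
qed

text \<open>A matrix can be rescaled to determinant one without changing the conjugation by it, so
  invariance under the adjoint group is invariance under all invertible matrices.\<close>

lemma rescale_to_det_1:
  fixes g :: "complex^'n^'n"
  assumes "invertible g"
  shows "\<exists>c. c \<noteq> 0 \<and> det (mscale c g) = 1"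
proof -
  have d: "det g \<noteq> 0" using assms by (simp add: invertible_det_nz)
  obtain c where c: "c ^ CARD('n) = inverse (det g)"
    using exists_complex_root[of "CARD('n)" "inverse (det g)"] zero_less_card_finite[where 'a='n]
    by (metis neq0_conv)
  have "mscale c g = diagmat (\<lambda>i. c) ** g" by (simp add: vec_eq_iff)
  then have "det (mscale c g) = c ^ CARD('n) * det g"
    by (simp add: det_mul) (simp add: det_diagonal)
  then have "det (mscale c g) = 1" using c d by simp
  moreover have "c \<noteq> 0"
    using c d zero_less_card_finite[where 'a='n] by (auto simp: power_0_left)
  ultimately show ?thesis by blast
qed

lemma family_algebra_iff: "U \<in> family_algebra x \<longleftrightarrow> equivariant (operator U)"
proof
  assume U: "U \<in> family_algebra x"
  have "operator U A' Y' ** g = g ** operator U A Y"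
    if g: "invertible g" and A: "A' ** g = g ** A" and Y: "Y' ** g = g ** Y" for g A A' Y Y'
  proof -
    obtain c where c: "c \<noteq> 0" "det (mscale c g) = 1" using rescale_to_det_1[OF g] by blast
    let ?g = "mscale c g"
    have "invertible ?g" using c(2) by (simp add: invertible_det_nz)
    then obtain h where h: "?g ** h = mat 1" "h ** ?g = mat 1"
      unfolding invertible_def by blast
    have conj: "h ** traceless_part Z' ** ?g = traceless_part Z" if "Z' ** g = g ** Z" for Z Z'
    proof -
      have "h ** traceless_part Z' ** ?g = h ** (?g ** traceless_part Z)"
        using traceless_part_intertwine[OF g that]
        by (simp add: mscale_mult_left mscale_mult_right flip: matrix_mul_assoc)
      then show ?thesis using h(2) by (simp add: matrix_mul_assoc)
    qed
    have "end_act x (Ad ?g) U = U"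
      using U c(2) unfolding family_algebra_def adjoint_group_def by blast
    then have "operator U A' Y'
        = operator (end_act x (Ad ?g) U) (traceless_part A') (traceless_part Y')"
      by (simp add: operator_traceless_part)
    also have "\<dots> = ?g ** operator U A Y ** h"
      unfolding operator_end_act[OF h traceless_part_in_sl] conj[OF A] conj[OF Y]
      by (simp add: operator_traceless_part)
    finally have "operator U A' Y' ** ?g = ?g ** operator U A Y ** (h ** ?g)"
      by (simp add: matrix_mul_assoc)
    then have "operator U A' Y' ** ?g = ?g ** operator U A Y"
      unfolding h(2) by simp
    then have "mscale c (operator U A' Y' ** g) = mscale c (g ** operator U A Y)"
      by (simp only: mscale_mult_left mscale_mult_right)
    then show ?thesis using c(1) mvs.scale_left_imp_eq by blast
  qed
  then show "equivariant (operator U)" by (simp add: equivariant_def)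
next
  assume equi: "equivariant (operator U)"
  have "end_act x (Ad g) U = U" if "det g = 1" for g
  proof (rule operator_inject)
    fix A Y :: "complex^'n^'n" assume "Y \<in> sl"
    have g: "invertible g" using that by (simp add: invertible_det_nz)
    then obtain h where h: "g ** h = mat 1" "h ** g = mat 1"
      unfolding invertible_def by blast
    have "Z ** g = g ** (h ** Z ** g)" for Z using h(1) by (simp add: matrix_mul_assoc)
    then have "operator U A Y ** g = g ** operator U (h ** A ** g) (h ** Y ** g)"
      using equivariantD[OF equi g] by blast
    then have "g ** operator U (h ** A ** g) (h ** Y ** g) ** h = operator U A Y ** (g ** h)"
      by (simp add: matrix_mul_assoc)
    then show "operator (end_act x (Ad g) U) A Y = operator U A Y"
      unfolding operator_end_act[OF h \<open>Y \<in> sl\<close>] using h(1) by simp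
  qed
  then show "U \<in> family_algebra x"
    unfolding family_algebra_def adjoint_group_def by blast
qed

lemma mat_invariant_in_family_algebra:
  assumes "P \<in> invariant_polys x"
  shows "mat P \<in> family_algebra x"
proof -
  have "end_act x (Ad g) (mat P) = mat P" if "det g = 1" for g
  proof (rule operator_inject)
    fix A Y :: "complex^'n^'n" assume "Y \<in> sl"
    obtain h where h: "g ** h = mat 1" "h ** g = mat 1"
      using \<open>det g = 1\<close> invertible_det_nz[of g] unfolding invertible_def by auto
    have "peval P (trace_point x (h ** A ** g)) = peval P (trace_point x A)"
      using assms \<open>det g = 1\<close> peval_poly_act[OF h, of P A]
      unfolding invariant_polys_def adjoint_group_def by force
    moreover have "g ** (h ** Y ** g) ** h = (g ** h) ** Y ** (g ** h)"
      by (simp only: matrix_mul_assoc)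
    ultimately show "operator (end_act x (Ad g) (mat P)) A Y = operator (mat P) A Y"
      unfolding operator_end_act[OF h \<open>Y \<in> sl\<close>] operator_mat
        traceless_part_sl[OF \<open>Y \<in> sl\<close>] traceless_part_sl[OF conjugate_in_sl[OF h(1) \<open>Y \<in> sl\<close>]]
      using h(1) by (simp add: mscale_mult_left mscale_mult_right)
  qed
  then show ?thesis
    unfolding family_algebra_def adjoint_group_def by blast
qed

text \<open>The invariance of the polynomial can be tested on its values, since every point of \<open>g\<^sup>*\<close> comes
  from a traceless matrix.\<close>

lemma invariant_polynomial_exists:
  assumes "invariant_fun f"
  shows "\<exists>P\<in>invariant_polys x. \<forall>A\<in>sl. peval P (trace_point x A) = f A"
proof -
  obtain P where P: "\<And>\<xi>. peval P \<xi> = f (point_matrix \<xi>)"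
    using matpoly_to_polynomial assms unfolding invariant_fun_def by blast
  have f: "peval P (trace_point x A) = f A" if "A \<in> sl" for A
    using that by (simp add: P point_matrix_trace_point traceless_part_sl)
  have "poly_act x (Ad g) P = P" if "det g = 1" for g
  proof (rule peval_eq_imp_eq)
    fix \<xi>
    let ?A = "point_matrix \<xi>"
    have g: "invertible g" using that by (simp add: invertible_det_nz)
    then obtain h where h: "g ** h = mat 1" "h ** g = mat 1"
      unfolding invertible_def by blast
    have "?A ** g = g ** (h ** ?A ** g)" using h(1) by (simp add: matrix_mul_assoc)
    then have "f ?A = f (h ** ?A ** g)"
      using assms g unfolding invariant_fun_def by blast
    then have "peval (poly_act x (Ad g) P) (trace_point x ?A) = peval P (trace_point x ?A)"
      unfolding peval_poly_act[OF h] f[OF point_matrix_in_sl]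
        f[OF conjugate_in_sl[OF h(1) point_matrix_in_sl]]
      by simp
    then show "peval (poly_act x (Ad g) P) \<xi> = peval P \<xi>"
      unfolding trace_point_point_matrix .
  qed
  then have "P \<in> invariant_polys x"
    unfolding invariant_polys_def adjoint_group_def by blast
  with f show ?thesis by blast
qed

section \<open>The three generators\<close>

lemma peval_trace_F_mat:
  "peval (trace (map_matrix pconst B ** map_matrix pconst C ** F_mat x)) (trace_point x A)
    = trace (B ** C ** traceless_part A)"
  by (simp add: trace_def matrix_matrix_mult_def peval_sum peval_F_mat point_matrix_trace_point)

lemma operator_L: "operator (L_elt x) A Y = traceless_part (traceless_part A ** traceless_part Y)"
proof -
  let ?A = "traceless_part A"
  have "peval (L_elt x $ \<alpha> $ \<beta>) (trace_point x A) = trace_coord x \<alpha> (?A ** x \<beta>)" for \<alpha> \<beta>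
  proof -
    have "trace (x \<beta> ** x \<gamma> ** ?A) = trace (x \<gamma> ** (?A ** x \<beta>))" for \<gamma>
      using trace_mul_sym[of "x \<beta>" "x \<gamma> ** ?A"] by (simp add: matrix_mul_assoc)
    then show ?thesis
      by (simp add: L_elt_def peval_sum peval_trace_F_mat trace_coord_def)
  qed
  then have "operator (L_elt x) A Y
      = combination x (\<lambda>\<alpha>. \<Sum>\<beta>\<in>UNIV. trace_coord x \<alpha> (?A ** x \<beta>) * trace_coord x \<beta> Y)"
    by (simp add: operator_def)
  also have "(\<lambda>\<alpha>. \<Sum>\<beta>\<in>UNIV. trace_coord x \<alpha> (?A ** x \<beta>) * trace_coord x \<beta> Y)
      = (\<lambda>\<alpha>. trace_coord x \<alpha> (?A ** traceless_part Y))"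
    unfolding combination_trace_coord[of Y, symmetric]
    by (simp add: combination_def matrix_sum_right mscale_mult_right trace_coord_sum
        trace_coord_mscale mult.commute)
  finally show ?thesis by (simp add: combination_trace_coord)
qed

lemma operator_R: "operator (R_elt x) A Y = traceless_part (traceless_part Y ** traceless_part A)"
proof -
  let ?A = "traceless_part A"
  have "peval (R_elt x $ \<alpha> $ \<beta>) (trace_point x A) = trace_coord x \<alpha> (x \<beta> ** ?A)" for \<alpha> \<beta>
    by (simp add: R_elt_def peval_sum peval_trace_F_mat trace_coord_def matrix_mul_assoc)
  then have "operator (R_elt x) A Y
      = combination x (\<lambda>\<alpha>. \<Sum>\<beta>\<in>UNIV. trace_coord x \<alpha> (x \<beta> ** ?A) * trace_coord x \<beta> Y)"
    by (simp add: operator_def)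
  also have "(\<lambda>\<alpha>. \<Sum>\<beta>\<in>UNIV. trace_coord x \<alpha> (x \<beta> ** ?A) * trace_coord x \<beta> Y)
      = (\<lambda>\<alpha>. trace_coord x \<alpha> (traceless_part Y ** ?A))"
    unfolding combination_trace_coord[of Y, symmetric]
    by (simp add: combination_def matrix_sum_left mscale_mult_left trace_coord_sum
        trace_coord_mscale mult.commute)
  finally show ?thesis by (simp add: combination_trace_coord)
qed

lemma operator_S: "operator (S_elt x) A Y
    = mscale (trace (traceless_part A ** traceless_part Y)) (traceless_part A)"
proof -
  have "peval (S_elt x $ \<alpha> $ \<beta>) (trace_point x A)
      = trace (x \<beta> ** traceless_part A) * trace_coord x \<alpha> A" for \<alpha> \<beta>
    by (simp add: S_elt_def peval_sum trace_coord_def trace_point_def trace_mult_traceless_part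
        sum_distrib_left mult_ac)
  then have "operator (S_elt x) A Y = combination x (\<lambda>\<alpha>.
      (\<Sum>\<beta>\<in>UNIV. trace_coord x \<beta> Y * trace (traceless_part A ** x \<beta>)) * trace_coord x \<alpha> A)"
    by (simp add: operator_def sum_distrib_left sum_distrib_right mult_ac
        trace_mul_sym[of _ "traceless_part A"])
  also have "(\<Sum>\<beta>\<in>UNIV. trace_coord x \<beta> Y * trace (traceless_part A ** x \<beta>))
      = trace (traceless_part A ** traceless_part Y)"
    using trace_mult_combination[of "traceless_part A" x "\<lambda>\<beta>. trace_coord x \<beta> Y"]
    by (simp only: combination_trace_coord)
  also have "combination x (\<lambda>\<alpha>. c * trace_coord x \<alpha> A) = mscale c (traceless_part A)" for c
    unfolding combination_scale combination_trace_coord ..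
  finally show ?thesis .
qed

lemma generators_in_family_algebra: "{L_elt x, R_elt x, S_elt x} \<subseteq> family_algebra x"
proof -
  have mult: "A' ** B' ** g = g ** (A ** B)" if "A' ** g = g ** A" "B' ** g = g ** B"
    for A B A' B' g :: "complex^'n^'n"
    using that by (metis matrix_mul_assoc)
  have "equivariant (operator (L_elt x))" "equivariant (operator (R_elt x))"
    unfolding equivariant_def operator_L operator_R
    by (intro allI impI traceless_part_intertwine mult; assumption)+
  moreover have "equivariant (operator (S_elt x))"
    unfolding equivariant_def operator_S
  proof (intro allI impI)
    fix g A A' Y Y' :: "complex^'n^'n"
    assume g: "invertible g" and "A' ** g = g ** A" and "Y' ** g = g ** Y"
    then have A: "traceless_part A' ** g = g ** traceless_part A"
      and Y: "traceless_part Y' ** g = g ** traceless_part Y"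
      by (simp_all add: traceless_part_intertwine)
    show "mscale (trace (traceless_part A' ** traceless_part Y')) (traceless_part A') ** g
        = g ** mscale (trace (traceless_part A ** traceless_part Y)) (traceless_part A)"
      unfolding trace_intertwine[OF g mult[OF A Y]]
      by (simp add: mscale_mult_left mscale_mult_right A)
  qed
  ultimately show ?thesis by (simp add: family_algebra_iff)
qed

lemma generated_subset_family_algebra:
  "generated_algebra (invariant_polys x) {L_elt x, R_elt x, S_elt x} \<subseteq> family_algebra x"
proof
  fix U assume "U \<in> generated_algebra (invariant_polys x) {L_elt x, R_elt x, S_elt x}"
  then show "U \<in> family_algebra x"
  proof (induction rule: generated_algebra.induct)
    case (coeff P)
    then show ?case by (rule mat_invariant_in_family_algebra)
  next
    case (gener T)
    then show ?case using generators_in_family_algebra by blast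
  next
    case (add T U)
    then show ?case
      by (simp add: family_algebra_iff equivariant_def operator_add[abs_def] matrix_add_ldistrib
          matrix_add_rdistrib)
  next
    case (mult T U)
    then show ?case
      by (simp add: family_algebra_iff equivariant_def operator_mult[abs_def])
  qed
qed

definition generated_family :: "(complex^'n^'n \<Rightarrow> complex^'n^'n \<Rightarrow> complex^'n^'n) \<Rightarrow> bool" where
  "generated_family T \<longleftrightarrow> (\<exists>U\<in>generated_algebra (invariant_polys x) {L_elt x, R_elt x, S_elt x}.
      \<forall>A\<in>sl. \<forall>Y\<in>sl. operator U A Y = T A Y)"

lemma generated_family_add:
  assumes "generated_family T" "generated_family T'"
  shows "generated_family (\<lambda>A Y. T A Y + T' A Y)"
proof -
  let ?G = "generated_algebra (invariant_polys x) {L_elt x, R_elt x, S_elt x}"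
  obtain U V where "U \<in> ?G" "\<forall>A\<in>sl. \<forall>Y\<in>sl. operator U A Y = T A Y"
    "V \<in> ?G" "\<forall>A\<in>sl. \<forall>Y\<in>sl. operator V A Y = T' A Y"
    using assms unfolding generated_family_def by blast
  then show ?thesis
    unfolding generated_family_def
    by (intro bexI[of _ "U + V"]) (simp_all add: operator_add generated_algebra.add)
qed

lemma generated_family_compose:
  assumes "generated_family T" "generated_family T'"
  shows "generated_family (\<lambda>A Y. T A (T' A Y))"
proof -
  let ?G = "generated_algebra (invariant_polys x) {L_elt x, R_elt x, S_elt x}"
  obtain U V where "U \<in> ?G" and U: "\<And>A Y. A \<in> sl \<Longrightarrow> Y \<in> sl \<Longrightarrow> operator U A Y = T A Y"
    and "V \<in> ?G" and V: "\<And>A Y. A \<in> sl \<Longrightarrow> Y \<in> sl \<Longrightarrow> operator V A Y = T' A Y"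
    using assms unfolding generated_family_def by blast
  have "operator (U ** V) A Y = T A (T' A Y)" if "A \<in> sl" "Y \<in> sl" for A Y
    using U[OF that(1) operator_in_sl, of V A Y] V[OF that] by (simp add: operator_mult)
  moreover have "U ** V \<in> ?G" using \<open>U \<in> ?G\<close> \<open>V \<in> ?G\<close> by (rule generated_algebra.mult)
  ultimately show ?thesis unfolding generated_family_def by blast
qed

lemma generated_family_invariant:
  assumes "invariant_fun f"
  shows "generated_family (\<lambda>A Y. mscale (f A) Y)"
proof -
  obtain P where "P \<in> invariant_polys x" "\<forall>A\<in>sl. peval P (trace_point x A) = f A"
    using invariant_polynomial_exists[OF assms] by blast
  then show ?thesis
    unfolding generated_family_def
    by (intro bexI[of _ "mat P"] generated_algebra.coeff)
      (simp_all add: operator_mat traceless_part_sl)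
qed

lemma generated_family_scale:
  assumes "invariant_fun f" "generated_family T"
  shows "generated_family (\<lambda>A Y. mscale (f A) (T A Y))"
  by (rule generated_family_compose[OF generated_family_invariant[OF assms(1)] assms(2)])

lemma generated_family_cong:
  assumes "generated_family T" "\<And>A Y. A \<in> sl \<Longrightarrow> Y \<in> sl \<Longrightarrow> T A Y = T' A Y"
  shows "generated_family T'"
  using assms unfolding generated_family_def by auto

lemma generated_family_0: "generated_family (\<lambda>A Y. 0)"
  using generated_family_cong[OF generated_family_invariant[OF invariant_fun_const[of 0]]] by simp

lemma generated_family_sum:
  "(\<And>i. i \<in> I \<Longrightarrow> generated_family (T i))
    \<Longrightarrow> generated_family (\<lambda>A Y. \<Sum>i\<in>I. T i A Y)"
  by (induction I rule: infinite_finite_induct)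
    (simp_all add: generated_family_0 generated_family_add)

lemma generated_family_L: "generated_family (\<lambda>A Y. traceless_part (A ** Y))"
  unfolding generated_family_def
  by (intro bexI[of _ "L_elt x"] generated_algebra.gener)
    (simp_all add: operator_L traceless_part_sl)

lemma generated_family_R: "generated_family (\<lambda>A Y. traceless_part (Y ** A))"
  unfolding generated_family_def
  by (intro bexI[of _ "R_elt x"] generated_algebra.gener)
    (simp_all add: operator_R traceless_part_sl)

lemma generated_family_S: "generated_family (\<lambda>A Y. mscale (trace (A ** Y)) A)"
  unfolding generated_family_def
  by (intro bexI[of _ "S_elt x"] generated_algebra.gener)
    (simp_all add: operator_S traceless_part_sl)

text \<open>Applying \<open>L\<close> after \<open>Y \<mapsto> tr(A\<^sup>l Y) A\<^sup>k\<close> raises \<open>k\<close>, applying it before raises \<open>l\<close>. Taking the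
  traceless part in \<open>L\<close> contributes an invariant multiple of \<open>S\<close> in the first case, and of the
  operator with \<open>l = 1\<close> in the second.\<close>

lemma generated_family_dyad: "generated_family (\<lambda>A Y. traceless_part (dyad k l A Y))"
proof -
  let ?n = "of_nat CARD('n) :: complex"
  have first: "generated_family (\<lambda>A Y. traceless_part (dyad k 1 A Y))" for k
  proof (induction k)
    case 0
    have "traceless_part (dyad 0 1 A Y) = 0" for A Y :: "complex^'n^'n"
      by (simp add: dyad_def traceless_part_def trace_mscale trace_I)
    then show ?case by (simp add: generated_family_0)
  next
    case step: (Suc k)
    show ?case
    proof (cases k)
      case 0
      show ?thesis
        by (rule generated_family_cong[OF generated_family_S])
          (simp add: 0 dyad_def traceless_part_mscale traceless_part_sl)
    next
      case (Suc k')
      have "generated_family (\<lambda>A Y. traceless_part (A ** traceless_part (dyad k 1 A Y))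
          + mscale (1 / ?n * trace (mpow A k)) (mscale (trace (A ** Y)) A))"
        by (rule generated_family_add[OF generated_family_compose[OF generated_family_L step.IH]
            generated_family_scale[OF invariant_fun_trace_mpow generated_family_S]])
      then show ?thesis
      proof (rule generated_family_cong)
        fix A Y :: "complex^'n^'n" assume "A \<in> sl"
        have "A ** traceless_part (dyad k 1 A Y)
            = dyad (Suc k) 1 A Y - mscale (trace (A ** Y) * trace (mpow A k) / ?n) A"
          by (simp add: traceless_part_def dyad_def matrix_diff_right_distrib mscale_mult_right
              trace_mscale)
        then have "dyad (Suc k) 1 A Y = A ** traceless_part (dyad k 1 A Y)
            + mscale (trace (A ** Y) * trace (mpow A k) / ?n) A" by simp
        then show "traceless_part (A ** traceless_part (dyad k 1 A Y))
            + mscale (1 / ?n * trace (mpow A k)) (mscale (trace (A ** Y)) A)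
            = traceless_part (dyad (Suc k) 1 A Y)"
          using \<open>A \<in> sl\<close>
          by (simp add: traceless_part_add traceless_part_mscale traceless_part_sl mult_ac)
      qed
    qed
  qed
  show ?thesis
  proof (induction l)
    case 0
    have "generated_family (\<lambda>A (Y :: complex^'n^'n). 0)" by (rule generated_family_0)
    then show ?case
      by (rule generated_family_cong) (simp add: dyad_def sl_def traceless_part_0)
  next
    case (Suc l)
    have "generated_family (\<lambda>A Y. traceless_part (dyad k l A (traceless_part (A ** Y)))
        + mscale (1 / ?n * trace (mpow A l)) (traceless_part (dyad k 1 A Y)))"
      by (rule generated_family_add[OF generated_family_compose[OF Suc.IH generated_family_L]
          generated_family_scale[OF invariant_fun_trace_mpow first]])
    then show ?case
    proof (rule generated_family_cong)
      fix A Y :: "complex^'n^'n"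
      have "trace (mpow A (Suc l) ** Y) = trace (mpow A l ** traceless_part (A ** Y))
          + 1 / ?n * trace (mpow A l) * trace (mpow A 1 ** Y)"
        by (simp add: traceless_part_def matrix_diff_right_distrib mscale_mult_right trace_sub
            trace_mscale mpow_1[unfolded One_nat_def[symmetric]] mpow_Suc_right[of A l]
            matrix_mul_assoc del: mpow.simps(2) One_nat_def)
      then show "traceless_part (dyad k l A (traceless_part (A ** Y)))
          + mscale (1 / ?n * trace (mpow A l)) (traceless_part (dyad k 1 A Y))
          = traceless_part (dyad k (Suc l) A Y)"
        by (simp only: dyad_def traceless_part_add traceless_part_mscale mvs.scale_left_distrib
            mvs.scale_scale)
    qed
  qed
qed

text \<open>Composition with \<open>L\<close> and \<open>R\<close> adds a factor \<open>A\<close> on the left or on the right of \<open>A\<^sup>k Y A\<^sup>l\<close>. Taking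
  the traceless part costs a multiple of \<open>Y \<mapsto> tr(A\<^sup>m Y) A\<close>, which is already generated.\<close>

lemma generated_family_sandwich: "generated_family (\<lambda>A Y. traceless_part (sandwich k l A Y))"
proof -
  let ?n = "of_nat CARD('n) :: complex"
  have S: "generated_family (\<lambda>A Y. mscale (1 / ?n * trace (mpow A m ** Y)) A)" for m
  proof -
    have "generated_family (\<lambda>A Y. mscale (1 / ?n) (traceless_part (dyad (Suc 0) m A Y)))"
      by (rule generated_family_scale[OF invariant_fun_const generated_family_dyad])
    then show ?thesis
    proof (rule generated_family_cong)
      fix A Y :: "complex^'n^'n" assume "A \<in> sl"
      then show "mscale (1 / ?n) (traceless_part (dyad (Suc 0) m A Y))
          = mscale (1 / ?n * trace (mpow A m ** Y)) A"
        by (simp only: dyad_def mpow_1 traceless_part_mscale traceless_part_sl mvs.scale_scale)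
    qed
  qed
  have zero: "generated_family (\<lambda>A Y. traceless_part (sandwich 0 l A Y))" for l
  proof (induction l)
    case 0
    show ?case
      by (rule generated_family_cong[OF generated_family_invariant[OF invariant_fun_const[of 1]]])
        (simp add: sandwich_def traceless_part_sl vec_eq_iff)
  next
    case (Suc l)
    have "generated_family (\<lambda>A Y. traceless_part (traceless_part (sandwich 0 l A Y) ** A)
        + mscale (1 / ?n * trace (mpow A l ** Y)) A)"
      by (rule generated_family_add[OF generated_family_compose[OF generated_family_R Suc.IH] S])
    then show ?case
    proof (rule generated_family_cong)
      fix A Y :: "complex^'n^'n" assume "A \<in> sl"
      have "sandwich 0 (Suc l) A Y = traceless_part (sandwich 0 l A Y) ** A
          + mscale (1 / ?n * trace (mpow A l ** Y)) A"
        by (simp add: traceless_part_def sandwich_def matrix_diff_left_distrib mscale_mult_left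
            trace_mul_sym[of Y] mpow_Suc_right matrix_mul_assoc del: mpow.simps(2))
      then show "traceless_part (traceless_part (sandwich 0 l A Y) ** A)
          + mscale (1 / ?n * trace (mpow A l ** Y)) A = traceless_part (sandwich 0 (Suc l) A Y)"
        using \<open>A \<in> sl\<close> by (simp add: traceless_part_add traceless_part_mscale traceless_part_sl)
    qed
  qed
  show ?thesis
  proof (induction k)
    case 0
    show ?case by (rule zero)
  next
    case (Suc k)
    have "generated_family (\<lambda>A Y. traceless_part (A ** traceless_part (sandwich k l A Y))
        + mscale (1 / ?n * trace (mpow A (l + k) ** Y)) A)"
      by (rule generated_family_add[OF generated_family_compose[OF generated_family_L Suc.IH] S])
    then show ?case
    proof (rule generated_family_cong)
      fix A Y :: "complex^'n^'n" assume "A \<in> sl"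
      have "trace (sandwich k l A Y) = trace (mpow A (l + k) ** Y)"
        using trace_mul_sym[of "mpow A k ** Y" "mpow A l"]
        by (simp add: sandwich_def mpow_add matrix_mul_assoc)
      then have "sandwich (Suc k) l A Y = A ** traceless_part (sandwich k l A Y)
          + mscale (1 / ?n * trace (mpow A (l + k) ** Y)) A"
        by (simp add: traceless_part_def sandwich_def matrix_diff_right_distrib mscale_mult_right
            matrix_mul_assoc)
      then show "traceless_part (A ** traceless_part (sandwich k l A Y))
          + mscale (1 / ?n * trace (mpow A (l + k) ** Y)) A = traceless_part (sandwich (Suc k) l A Y)"
        using \<open>A \<in> sl\<close> by (simp add: traceless_part_add traceless_part_mscale traceless_part_sl)
    qed
  qed
qed

lemma family_algebra_subset_generated:
  "family_algebra x \<subseteq> generated_algebra (invariant_polys x) {L_elt x, R_elt x, S_elt x}"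
proof
  fix U assume "U \<in> family_algebra x"
  then have "covariant (operator U)"
    by (simp add: family_algebra_iff covariant_operator)
  then obtain P Q :: "'n \<Rightarrow> 'n \<Rightarrow> complex^'n^'n \<Rightarrow> complex"
    where P: "\<And>k l. invariant_fun (P k l)" and Q: "\<And>k l. invariant_fun (Q k l)"
      and eq: "\<And>A Y. operator U A Y
        = (\<Sum>k\<in>UNIV. \<Sum>l\<in>UNIV. mscale (P k l A) (sandwich (idx k) (idx l) A Y))
        + (\<Sum>k\<in>UNIV. \<Sum>l\<in>UNIV. mscale (Q k l A) (dyad (idx k) (idx l) A Y))"
    by (rule covariant_decomposition) blast
  have "generated_family (\<lambda>A Y.
      (\<Sum>k\<in>UNIV. \<Sum>l\<in>UNIV. mscale (P k l A) (traceless_part (sandwich (idx k) (idx l) A Y)))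
      + (\<Sum>k\<in>UNIV. \<Sum>l\<in>UNIV. mscale (Q k l A) (traceless_part (dyad (idx k) (idx l) A Y))))"
    by (intro generated_family_add generated_family_sum generated_family_scale P Q
        generated_family_sandwich generated_family_dyad)
  then have "generated_family (operator U)"
  proof (rule generated_family_cong)
    fix A Y :: "complex^'n^'n"
    have "operator U A Y = traceless_part (operator U A Y)"
      by (simp add: traceless_part_sl operator_in_sl)
    then show "(\<Sum>k\<in>UNIV. \<Sum>l\<in>UNIV. mscale (P k l A) (traceless_part (sandwich (idx k) (idx l) A Y)))
        + (\<Sum>k\<in>UNIV. \<Sum>l\<in>UNIV. mscale (Q k l A) (traceless_part (dyad (idx k) (idx l) A Y)))
        = operator U A Y"
      unfolding eq by (simp add: traceless_part_add traceless_part_sum traceless_part_mscale)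
  qed
  then obtain V where "V \<in> generated_algebra (invariant_polys x) {L_elt x, R_elt x, S_elt x}"
    "\<And>A Y. A \<in> sl \<Longrightarrow> Y \<in> sl \<Longrightarrow> operator V A Y = operator U A Y"
    unfolding generated_family_def by blast
  then show "U \<in> generated_algebra (invariant_polys x) {L_elt x, R_elt x, S_elt x}"
    using operator_inject[of V U] by simp
qed

end

theorem theorem1:
  fixes x :: "'a::finite \<Rightarrow> complex^'n^'n"
  assumes "CARD('n) \<ge> 4"
    and "is_basis x sl"
  shows "generated_algebra (invariant_polys x) {L_elt x, R_elt x, S_elt x} = family_algebra x"
proof -
  interpret sl_basis x
    using assms(2) by unfold_locales
  show ?thesis
    using generated_subset_family_algebra family_algebra_subset_generated by (rule subset_antisym)
qed

end
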